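(* Let $G^N$ be the standard Gaussian measure on $\mathbb{R}^N$. Then for all $\nu\in\mathcal P(\mathbb{R}^N)$, $$2\,Ent(\nu|G^N)\ \ge\ \mathcal T_{bc,2}(G^N,\nu):=\inf_{\gamma\in\Pi_{bc}(G^N,\nu)}\int\sum_{i=1}^N|x_i-y_i|^2\,d\gamma(x,y).$$
   Context: $Ent(\nu|G)=\int\log\frac{d\nu}{dG}\,d\nu$ if $\nu\ll G$, and $+\infty$ otherwise. For $\mu,\nu\in\mathcal P(\mathbb{R}^N)$, $\Pi(\mu,\nu)$ is the set of couplings on $\mathbb{R}^N\times\mathbb{R}^N$. $\gamma\in\Pi(\mu,\nu)$ is causal, $\gamma\in\Pi_c(\mu,\nu)$, if for every $t\in\{1,\dots,N\}$ and $B\in\sigma(y_1,\dots,y_t)$ the map $x\mapsto\gamma^x(B)$ (with $\gamma^x$ the conditional law of $y$ given $x$) is $\sigma(x_1,\dots,x_t)$-measurable up to a $\mu$-null set. $\Pi_{bc}(\mu,\nu)$ is the set of $\gamma\in\Pi_c(\mu,\nu)$ whose image under $(x,y)\mapsto(y,x)$ belongs to $\Pi_c(\nu,\mu)$. *)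

theory Defs
  imports "HOL-Probability.Probability"
begin

text \<open>
  Points of \<open>\<real>\<^sup>N\<close> are extensional functions on the time indices \<open>{1..N}\<close>, with the Borel
  (product) sigma-algebra.
\<close>

definition RN :: "nat \<Rightarrow> (nat \<Rightarrow> real) measure" where
  "RN N = PiM {1..N} (\<lambda>_. borel)"

definition prob_measures :: "nat \<Rightarrow> (nat \<Rightarrow> real) measure set" where
  "prob_measures N = {\<mu>. prob_space \<mu> \<and> sets \<mu> = sets (RN N)}"

definition std_gaussian :: "nat \<Rightarrow> (nat \<Rightarrow> real) measure" where
  "std_gaussian N = PiM {1..N} (\<lambda>_. density lborel (\<lambda>x. ennreal (std_normal_density x)))"

text \<open>
  The entropy is an extended real. The library's \<open>KL_divergence\<close> is a Bochner integral, which
  is \<open>0\<close> when the logarithm is not integrable, so the integral is taken here as the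
  difference of the integrals of the positive and negative parts (\<open>ennreal\<close> sends negative
  numbers to \<open>0\<close>). For probability measures the second term is finite.
\<close>

definition Ent :: "'a measure \<Rightarrow> 'a measure \<Rightarrow> ereal" where
  "Ent \<nu> G =
    (if absolutely_continuous G \<nu>
     then enn2ereal (\<integral>\<^sup>+x. ennreal (ln (enn2real (RN_deriv G \<nu> x))) \<partial>\<nu>)
        - enn2ereal (\<integral>\<^sup>+x. ennreal (- ln (enn2real (RN_deriv G \<nu> x))) \<partial>\<nu>)
     else \<infinity>)"

definition couplings ::
  "nat \<Rightarrow> (nat \<Rightarrow> real) measure \<Rightarrow> (nat \<Rightarrow> real) measure
    \<Rightarrow> ((nat \<Rightarrow> real) \<times> (nat \<Rightarrow> real)) measure set" where
  "couplings N \<mu> \<nu> =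
    {\<gamma>. prob_space \<gamma> \<and> sets \<gamma> = sets (RN N \<Otimes>\<^sub>M RN N) \<and>
        distr \<gamma> (RN N) fst = \<mu> \<and> distr \<gamma> (RN N) snd = \<nu>}"

text \<open>The sigma-algebra on \<open>\<real>\<^sup>N\<close> generated by the first \<open>t\<close> coordinates.\<close>

definition past :: "nat \<Rightarrow> nat \<Rightarrow> (nat \<Rightarrow> real) measure" where
  "past N t = vimage_algebra (space (RN N)) (\<lambda>x. restrict x {1..t}) (RN t)"

text \<open>\<open>K x\<close> is a version of the conditional law of \<open>y\<close> given \<open>x\<close> under \<open>\<gamma>\<close>.\<close>

definition conditional_law ::
  "nat \<Rightarrow> (nat \<Rightarrow> real) measure \<Rightarrow> ((nat \<Rightarrow> real) \<times> (nat \<Rightarrow> real)) measure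
    \<Rightarrow> ((nat \<Rightarrow> real) \<Rightarrow> (nat \<Rightarrow> real) measure) \<Rightarrow> bool" where
  "conditional_law N \<mu> \<gamma> K \<longleftrightarrow>
    K \<in> RN N \<rightarrow>\<^sub>M prob_algebra (RN N) \<and>
    (\<forall>A\<in>sets (RN N). \<forall>B\<in>sets (RN N).
      emeasure \<gamma> (A \<times> B) = (\<integral>\<^sup>+x\<in>A. emeasure (K x) B \<partial>\<mu>))"

definition measurable_up_to_null :: "'a measure \<Rightarrow> 'a measure \<Rightarrow> ('a \<Rightarrow> ennreal) \<Rightarrow> bool" where
  "measurable_up_to_null \<mu> F f \<longleftrightarrow> (\<exists>g\<in>borel_measurable F. AE x in \<mu>. f x = g x)"

text \<open>
  The conditional law exists and is unique up to a \<open>\<mu>\<close>-null set, because \<open>\<real>\<^sup>N\<close> is standard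
  Borel, so the condition below does not depend on the version \<open>K\<close>.
\<close>

definition causal_couplings ::
  "nat \<Rightarrow> (nat \<Rightarrow> real) measure \<Rightarrow> (nat \<Rightarrow> real) measure
    \<Rightarrow> ((nat \<Rightarrow> real) \<times> (nat \<Rightarrow> real)) measure set" where
  "causal_couplings N \<mu> \<nu> =
    {\<gamma>\<in>couplings N \<mu> \<nu>.
      \<exists>K. conditional_law N \<mu> \<gamma> K \<and>
        (\<forall>t\<in>{1..N}. \<forall>B\<in>sets (past N t).
          measurable_up_to_null \<mu> (past N t) (\<lambda>x. emeasure (K x) B))}"

definition bicausal_couplings ::
  "nat \<Rightarrow> (nat \<Rightarrow> real) measure \<Rightarrow> (nat \<Rightarrow> real) measure
    \<Rightarrow> ((nat \<Rightarrow> real) \<times> (nat \<Rightarrow> real)) measure set" where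
  "bicausal_couplings N \<mu> \<nu> =
    {\<gamma>\<in>causal_couplings N \<mu> \<nu>.
      distr \<gamma> (RN N \<Otimes>\<^sub>M RN N) (\<lambda>(x, y). (y, x)) \<in> causal_couplings N \<nu> \<mu>}"

definition T_bc2 :: "nat \<Rightarrow> (nat \<Rightarrow> real) measure \<Rightarrow> (nat \<Rightarrow> real) measure \<Rightarrow> ennreal" where
  "T_bc2 N \<mu> \<nu> =
    (INF \<gamma>\<in>bicausal_couplings N \<mu> \<nu>.
      \<integral>\<^sup>+(x, y). ennreal (\<Sum>i=1..N. \<bar>x i - y i\<bar>\<^sup>2) \<partial>\<gamma>)"

end

theory Submission imports Defs
begin

text \<open>
  The coupling is the law of \<open>(S y, y)\<close> under \<open>\<nu>\<close>, where \<open>S\<close> is the Knothe--Rosenblatt map: its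
  coordinate \<open>s\<^sub>i\<close> is the monotone rearrangement onto the standard Gaussian of the conditional law of
  \<open>y\<^sub>i\<close> given \<open>y\<^sub>1, \<dots>, y\<^sub>i\<^sub>-\<^sub>1\<close>. Both \<open>S\<close> and its inverse are adapted, so the coupling is bicausal.

  With \<open>p\<close> the conditional density, \<open>g\<close> the Gaussian density and \<open>r = p / g(s)\<close>, which plays the role
  of the derivative of \<open>s\<close>, one has
  \<open>2 ln (p / g(z)) - (s - z)\<^sup>2 = 2 ln r + 2 s (z - s) \<ge> 2 (1 - 1 / r) + 2 s z - 2 s\<^sup>2\<close>.
  The right-hand side has nonnegative mean: \<open>s\<close> is Gaussian, hence \<open>E s\<^sup>2 = 1\<close>, and
  \<open>E [s; z > a] = g(s(a))\<close> gives \<open>E [s z] = \<integral> g(s(a)) da \<ge> E [1 / r]\<close>. In this way,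
  no differentiability of \<open>s\<close> is needed. Summing over the coordinates yields the theorem.
\<close>

section \<open>Monotone rearrangement on the line\<close>

text \<open>The bound E[1 / r] \<le> E[s z] is one half of Gaussian integration by parts. If t is
  the inverse of s on a line and x is Gaussian, then formally E[x t(x)] = E[t'(x)], and t' = 1 / r
  along s. The inverse jumps across every gap of the source law, and these jumps only enlarge
  E[s z]. So an inequality survives for arbitrary densities, in the direction that is needed.

  Two obstacles shape the rest. The covariance E[s z] is controlled only when z has a second moment,
  which is not assumed. Finite entropy supplies it, because a Gaussian has exponential moments of
  its square; infinite entropy leaves nothing to prove. Moreover, the conditional log-densities of
  the single coordinates are not known to be integrable, so they are never integrated one by one:
  the pointwise bounds telescope to the logarithm of the whole density, and only the remainders are
  integrated coordinate by coordinate.\<close>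

definition quantile :: "(real \<Rightarrow> real) \<Rightarrow> real \<Rightarrow> real" where
  "quantile F u = (if 0 < u \<and> u < 1 then Inf {z. u \<le> F z} else 0)"

text \<open>Right-continuity of the distribution function makes the infimum attained. This Galois
  connection turns sublevel sets of quantiles into conditions on \<open>cdf\<close>, which is how
  laws and measurability are obtained below.\<close>

lemma (in real_distribution) quantile_le_iff:
  assumes "0 < u" "u < 1"
  shows "quantile (cdf M) u \<le> a \<longleftrightarrow> u \<le> cdf M a"
proof -
  interpret cdf_distribution M ..
  show ?thesis
    using pseudoinverse[OF assms, of a] assms by (simp add: quantile_def)
qed

lemma (in real_distribution) cdf_measurable: "cdf M \<in> borel_measurable borel"
  by (intro borel_measurable_mono monoI cdf_nondecreasing)

text \<open>By the Galois connection, for u in (0,1) the sublevel condition at a reads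
  \<open>u \<le> cdf (\<kappa> x) a\<close>, so measurability in x for each fixed a suffices. The
  parameter x will be the past on which a conditional law depends.\<close>

lemma borel_measurable_quantile_kernel:
  fixes \<kappa> :: "'a \<Rightarrow> real measure"
  assumes \<kappa>: "\<And>x. x \<in> space A \<Longrightarrow> real_distribution (\<kappa> x)"
    and meas: "\<And>a. (\<lambda>x. cdf (\<kappa> x) a) \<in> borel_measurable A"
  shows "(\<lambda>(x, u). quantile (cdf (\<kappa> x)) u) \<in> borel_measurable (A \<Otimes>\<^sub>M borel)"
proof (rule borel_measurableI_le)
  fix a
  note meas[of a, measurable]
  have iff: "quantile (cdf (\<kappa> x)) u \<le> a
      \<longleftrightarrow> (if 0 < u \<and> u < 1 then u \<le> cdf (\<kappa> x) a else 0 \<le> a)" if "x \<in> space A" for x u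
  proof (cases "0 < u \<and> u < 1")
    case True
    then show ?thesis
      using real_distribution.quantile_le_iff[OF \<kappa>[OF that], of u a] by simp
  next
    \<comment> \<open>Outside (0,1) the infimum may run over an empty set or one unbounded below,
      hence the default value 0 in \<open>quantile\<close>.\<close>
    case False
    then show ?thesis by (auto simp: quantile_def)
  qed
  have "{w \<in> space (A \<Otimes>\<^sub>M borel). (case w of (x, u) \<Rightarrow> quantile (cdf (\<kappa> x)) u) \<le> a}
      = {w \<in> space (A \<Otimes>\<^sub>M borel). if 0 < snd w \<and> snd w < 1 then snd w \<le> cdf (\<kappa> (fst w)) a else 0 \<le> a}"
    by (rule Collect_cong) (auto simp: space_pair_measure iff)
  also have "\<dots> \<in> sets (A \<Otimes>\<^sub>M borel)"
    by measurable
  finally show "{w \<in> space (A \<Otimes>\<^sub>M borel). (case w of (x, u) \<Rightarrow> quantile (cdf (\<kappa> x)) u) \<le> a} \<in> sets (A \<Otimes>\<^sub>M borel)" .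
qed

lemma (in real_distribution) quantile_measurable: "quantile (cdf M) \<in> borel_measurable borel"
proof -
  \<comment> \<open>A single law is a kernel over a one-point parameter space.\<close>
  have "(\<lambda>u. (\<lambda>(x::unit, u). quantile (cdf M) u) ((), u)) \<in> borel_measurable borel"
    by (rule measurable_compose[OF _ borel_measurable_quantile_kernel[where A="count_space UNIV" and \<kappa>="\<lambda>_. M"]])
      (auto intro: real_distribution_axioms)
  then show ?thesis by simp
qed

section \<open>Continuous distribution functions and the uniform law\<close>

locale atomless_distribution = real_distribution +
  assumes atomless: "measure M {x} = 0"
begin

lemma isCont_cdf': "isCont (cdf M) x"
  using isCont_cdf atomless by simp

lemma continuous_on_cdf: "continuous_on A (cdf M)"
  using isCont_cdf' by (simp add: continuous_at_imp_continuous_on)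

lemma cdf_attains:
  assumes "0 < u" "u < 1"
  obtains c where "cdf M c = u"
proof -
  obtain a where a: "cdf M a < u"
    using order_tendstoD(2)[OF cdf_lim_at_bot \<open>0 < u\<close>] by (auto dest: eventually_happens)
  obtain b where b: "u < cdf M b"
    using order_tendstoD(1)[OF cdf_lim_at_top_prob \<open>u < 1\<close>] by (auto dest: eventually_happens)
  have "a \<le> b"
    using a b cdf_nondecreasing[of b a] by linarith
  then show ?thesis
    using IVT'[of "cdf M" a u b] a b continuous_on_cdf that by auto
qed

lemma measure_Ioc: "a \<le> b \<Longrightarrow> measure M {a<..b} = cdf M b - cdf M a"
  by (cases "a = b") (use cdf_diff_eq[of a b] in auto)

text \<open>If \<open>cdf M\<close> rises again to the right of c, compactness gives a last point s
  of the flat stretch, and the mass of (c, s] is the increment of \<open>cdf M\<close>, which is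
  zero. Otherwise \<open>cdf M\<close> is constant up to infinity, so its value there is 1 and the
  whole tail is null.\<close>

lemma flat_null: "measure M {z. c < z \<and> cdf M z \<le> cdf M c} = 0"
proof (cases "\<exists>b>c. cdf M b > cdf M c")
  case True
  then obtain b where b: "b > c" "cdf M b > cdf M c" by auto
  let ?D = "{c..b} \<inter> {z. cdf M z \<le> cdf M c}"
  have "closed {z. cdf M z \<le> cdf M c}"
    using continuous_on_cdf by (intro closed_Collect_le) auto
  then have "compact ?D"
    by (intro compact_Int_closed) auto
  moreover have "c \<in> ?D" using b by auto
  ultimately obtain s where s: "s \<in> ?D" "\<And>t. t \<in> ?D \<Longrightarrow> t \<le> s"
    using compact_attains_sup[of ?D] by blast
  have "{z. c < z \<and> cdf M z \<le> cdf M c} \<subseteq> {c<..s}"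
  proof
    fix z assume z: "z \<in> {z. c < z \<and> cdf M z \<le> cdf M c}"
    then have "z \<le> b"
      using b cdf_nondecreasing[of b z] by force
    then show "z \<in> {c<..s}" using z s(2)[of z] by auto
  qed
  then have "measure M {z. c < z \<and> cdf M z \<le> cdf M c} \<le> measure M {c<..s}"
    by (intro finite_measure_mono) auto
  also have "\<dots> = cdf M s - cdf M c"
    using s(1) by (intro measure_Ioc) auto
  also have "\<dots> \<le> 0" using s(1) by auto
  finally show ?thesis using measure_nonneg[of M] by (meson antisym)
next
  case False
  have "(cdf M \<longlongrightarrow> cdf M c) at_top"
  proof (intro tendsto_eventually eventually_mono[OF eventually_gt_at_top[of c]])
    fix z assume "c < z"
    then show "cdf M z = cdf M c"
      using False cdf_nondecreasing[of c z] by (meson antisym less_imp_le not_less)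
  qed
  then have "cdf M c = 1"
    using cdf_lim_at_top_prob by (rule tendsto_unique[rotated]) simp
  then have "measure M {..c} = 1" by (simp add: cdf_def)
  moreover have "{c<..} = space M - {..c}" by auto
  ultimately have "measure M {c<..} = 0"
    by (simp add: prob_compl del: space_eq_univ)
  moreover have "measure M {z. c < z \<and> cdf M z \<le> cdf M c} \<le> measure M {c<..}"
    by (intro finite_measure_mono) auto
  ultimately show ?thesis using measure_nonneg[of M] by (metis antisym)
qed

lemma AE_not_flat: "AE z in M. c < z \<longrightarrow> cdf M c < cdf M z"
proof -
  note cdf_measurable[measurable]
  have "AE z in M. z \<notin> {z. c < z \<and> cdf M z \<le> cdf M c}"
    using flat_null[of c] by (intro AE_not_in) (auto simp: null_sets_def emeasure_eq_measure)
  then show ?thesis by eventually_elim auto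
qed

text \<open>Continuity provides c with \<open>cdf M c = u\<close>; the set then differs from the
  half-line up to c only by a null flat stretch. In other words, \<open>cdf M\<close> is uniformly
  distributed under \<open>M\<close>.\<close>

lemma measure_cdf_le:
  assumes "0 < u" "u < 1"
  shows "measure M {z. cdf M z \<le> u} = u"
proof -
  note cdf_measurable[measurable]
  obtain c where c: "cdf M c = u" using cdf_attains[OF assms] .
  have "measure M {z. cdf M z \<le> u} = measure M {..c}"
  proof (rule finite_measure_eq_AE)
    show "AE x in M. (x \<in> {z. cdf M z \<le> u}) = (x \<in> {..c})"
      using AE_not_flat[of c]
      by eventually_elim (use c cdf_nondecreasing in \<open>auto simp: not_le[symmetric]\<close>)
  qed auto
  then show ?thesis using c by (simp add: cdf_def)
qed

text \<open>The uniform law does not charge its endpoints. As \<open>measure_cdf_le\<close> speaks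
  of levels inside (0,1), the endpoints are reached by letting e tend to 0 and u tend to 1.\<close>

lemma AE_cdf_bounds: "AE z in M. 0 < cdf M z \<and> cdf M z < 1"
proof -
  note cdf_measurable[measurable]
  have "measure M {z. cdf M z \<le> 0} \<le> e" if "0 < e" "e < 1" for e
    using measure_cdf_le[OF that] that by (auto intro!: finite_measure_mono elim!: subst)
  then have "measure M {z. cdf M z \<le> 0} \<le> 0"
    by (intro dense_ge_bounded[of 0 1]) auto
  then have "measure M {z. cdf M z \<le> 0} = 0"
    using measure_nonneg[of M] by (meson antisym)
  then have 1: "AE z in M. z \<notin> {z. cdf M z \<le> 0}"
    by (intro AE_not_in) (auto simp: null_sets_def emeasure_eq_measure)
  have "u \<le> measure M {z. cdf M z < 1}" if "0 < u" "u < 1" for u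
    using measure_cdf_le[OF that] that by (auto intro!: finite_measure_mono elim!: subst)
  then have "1 \<le> measure M {z. cdf M z < 1}"
    by (intro dense_le_bounded[of 0 1]) auto
  then have "measure M {z. cdf M z < 1} = 1"
    using prob_le_1 by (meson antisym)
  then have 2: "AE z in M. z \<in> {z. cdf M z < 1}"
    by (intro AE_prob_1) auto
  show ?thesis using 1 2 by eventually_elim auto
qed

lemma cdf_quantile:
  assumes "0 < u" "u < 1"
  shows "cdf M (quantile (cdf M) u) = u"
proof (rule antisym)
  obtain c where c: "cdf M c = u" using cdf_attains[OF assms] .
  then have "quantile (cdf M) u \<le> c" using quantile_le_iff[OF assms] by simp
  then show "cdf M (quantile (cdf M) u) \<le> u" using c cdf_nondecreasing by blast
  show "u \<le> cdf M (quantile (cdf M) u)" using quantile_le_iff[OF assms] by blast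
qed

text \<open>The quantile picks the leftmost point of a level set of \<open>cdf M\<close>, so z is
  recovered unless some point to its left has the same value. A rational such point then exists too,
  which makes the exceptional set a countable union of null sets.\<close>

lemma AE_quantile_cdf: "AE z in M. quantile (cdf M) (cdf M z) = z"
proof -
  have "AE z in M. \<forall>q::rat. of_rat q < z \<longrightarrow> cdf M (of_rat q) < cdf M z"
    using AE_not_flat by (subst AE_all_countable) auto
  with AE_cdf_bounds show ?thesis
  proof eventually_elim
    case (elim z)
    then have le: "quantile (cdf M) (cdf M z) \<le> z" by (simp add: quantile_le_iff)
    moreover have False if less: "quantile (cdf M) (cdf M z) < z"
    proof -
      obtain q where q: "quantile (cdf M) (cdf M z) < of_rat q" "of_rat q < z"
        using of_rat_dense[OF less] by blast
      then have "cdf M z \<le> cdf M (of_rat q)"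
        using elim by (subst quantile_le_iff[symmetric]) auto
      with q elim show False by force
    qed
    ultimately show ?case by force
  qed
qed

end

definition rearrange :: "real measure \<Rightarrow> real measure \<Rightarrow> real \<Rightarrow> real" where
  "rearrange M N z = quantile (cdf N) (cdf M z)"

text \<open>By the Galois connection, the image is at most a exactly when
  \<open>cdf M z \<le> cdf N a\<close>, almost everywhere, and that event has mass
  \<open>cdf N a\<close> by uniformity. This is where the absence of atoms in the source
  enters.\<close>

lemma distr_rearrange:
  assumes M: "atomless_distribution M" and N: "real_distribution N"
  shows "distr M borel (rearrange M N) = N"
proof (rule cdf_unique)
  interpret M: atomless_distribution M by fact
  interpret N: real_distribution N by fact
  note M.cdf_measurable[measurable] N.quantile_measurable[measurable]
  have [measurable]: "rearrange M N \<in> borel_measurable borel"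
    unfolding rearrange_def[abs_def] by measurable
  show "real_distribution (distr M borel (rearrange M N))"
    by auto
  show "cdf (distr M borel (rearrange M N)) = cdf N"
  proof
    fix a
    have "cdf (distr M borel (rearrange M N)) a = measure M {z. rearrange M N z \<le> a}"
      by (auto simp: cdf_def measure_distr intro!: arg_cong2[where f=measure])
    also have "\<dots> = measure M {z. cdf M z \<le> cdf N a}"
    proof (rule M.finite_measure_eq_AE)
      show "AE z in M. (z \<in> {z. rearrange M N z \<le> a}) = (z \<in> {z. cdf M z \<le> cdf N a})"
        using M.AE_cdf_bounds
        by eventually_elim (auto simp: rearrange_def N.quantile_le_iff)
    qed auto
    also have "\<dots> = cdf N a"
    proof -
      \<comment> \<open>Uniformity covers levels strictly between 0 and 1; the two extreme levels
        are treated by hand.\<close>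
      consider "cdf N a \<le> 0" | "0 < cdf N a" "cdf N a < 1" | "cdf N a = 1"
        using N.cdf_bounded_prob[of a] by linarith
      then show ?thesis
      proof cases
        case 1
        then have "cdf N a = 0" using N.cdf_nonneg[of a] by linarith
        moreover have "measure M {z. cdf M z \<le> 0} = measure M {}"
          by (rule M.finite_measure_eq_AE) (use M.AE_cdf_bounds in auto)
        ultimately show ?thesis by simp
      next
        case 3
        have "{z. cdf M z \<le> 1} = space M" using M.cdf_bounded_prob by auto
        then show ?thesis using 3 M.prob_space by simp
      qed (rule M.measure_cdf_le)
    qed
    finally show "cdf (distr M borel (rearrange M N)) a = cdf N a" .
  qed
qed fact

text \<open>The inner pair of \<open>cdf N\<close> and its quantile cancels because
  \<open>cdf N\<close> is continuous; the outer pair cancels only off the flat stretches of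
  \<open>cdf M\<close>, hence almost everywhere.\<close>

lemma AE_rearrange_inverse:
  assumes M: "atomless_distribution M" and N: "atomless_distribution N"
  shows "AE z in M. rearrange N M (rearrange M N z) = z"
proof -
  interpret M: atomless_distribution M by fact
  interpret N: atomless_distribution N by fact
  show ?thesis
    using M.AE_cdf_bounds M.AE_quantile_cdf
    by eventually_elim (simp add: rearrange_def N.cdf_quantile)
qed

section \<open>Rearrangement onto the Gaussian\<close>

abbreviation gauss :: "real measure" where
  "gauss \<equiv> density lborel (\<lambda>x. ennreal (std_normal_density x))"

lemma atomless_distribution_density:
  assumes "prob_space (density lborel p)" and [measurable]: "p \<in> borel_measurable borel"
  shows "atomless_distribution (density lborel p)"
proof -
  interpret prob_space "density lborel p" by fact
  have "AE x in density lborel p. x \<notin> {y}" for y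
    using AE_lborel_singleton[of y] by (auto simp: AE_density elim: eventually_mono)
  then have "emeasure (density lborel p) {y} = 0" for y
    by (subst (asm) AE_iff_measurable[OF _ refl]) (auto simp: Collect_conv_if)
  then show ?thesis
    by unfold_locales (auto simp: measure_def)
qed

lemma prob_space_gauss: "prob_space gauss"
  by (rule prob_space_normal_density) simp

lemma atomless_distribution_gauss: "atomless_distribution gauss"
  by (rule atomless_distribution_density[OF prob_space_gauss]) simp

text \<open>The Gaussian density g satisfies g'(x) = - x g(x), so - g is a primitive of x g(x), and
  it vanishes at infinity.\<close>

lemma gauss_tail_mean:
  "(\<integral>x. x * indicator {c<..} x \<partial>gauss) = std_normal_density c"
proof -
  have int: "integrable lborel (\<lambda>x. std_normal_density x * x)"
    using integrable_std_normal_moment[of 1] by simp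
  have "(LBINT x=ereal c..\<infinity>. std_normal_density x * x) = 0 - (- std_normal_density c)"
  proof (rule interval_integral_FTC_integrable[where F="\<lambda>x. - std_normal_density x"])
    fix x :: real
    show "((\<lambda>x. - std_normal_density x) has_vector_derivative std_normal_density x * x) (at x)"
      unfolding has_real_derivative_iff_has_vector_derivative[symmetric] std_normal_density_def
      by (auto intro!: derivative_eq_intros simp: field_simps)
    show "isCont (\<lambda>x. std_normal_density x * x) x"
      unfolding std_normal_density_def by (intro continuous_intros) auto
  next
    show "set_integrable lborel (einterval (ereal c) \<infinity>) (\<lambda>x. std_normal_density x * x)"
      unfolding set_integrable_def using int by (intro integrable_mult_indicator) auto
    have "isCont (\<lambda>x. - std_normal_density x) c"
      unfolding std_normal_density_def by (intro continuous_intros) auto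
    then have "((\<lambda>x. - std_normal_density x) \<longlongrightarrow> - std_normal_density c) (at_right c)"
      by (simp add: isCont_def filterlim_at_split)
    then show "(((\<lambda>x. - std_normal_density x) \<circ> real_of_ereal) \<longlongrightarrow> - std_normal_density c) (at_right (ereal c))"
      by (simp add: ereal_tendsto_simps)
    have "((\<lambda>x. - std_normal_density x) \<longlongrightarrow> 0) at_top"
      unfolding std_normal_density_def by real_asymp
    then show "(((\<lambda>x. - std_normal_density x) \<circ> real_of_ereal) \<longlongrightarrow> 0) (at_left \<infinity>)"
      by (simp add: ereal_tendsto_simps)
  qed simp
  then have "(\<integral>x. std_normal_density x * x * indicator {c<..} x \<partial>lborel) = std_normal_density c"
    by (simp add: interval_integral_to_infinity_eq set_lebesgue_integral_def mult.commute)
  then show ?thesis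
    by (subst integral_density) (auto simp: mult.assoc)
qed

lemma gauss_mean: "integrable gauss (\<lambda>x. x)" "(\<integral>x. x \<partial>gauss) = 0"
  using std_normal_moment_odd[of 0]
  by (auto simp: has_bochner_integral_iff integrable_density integral_density)

lemma gauss_variance: "integrable gauss (\<lambda>x. x\<^sup>2)" "(\<integral>x. x\<^sup>2 \<partial>gauss) = 1"
  using std_normal_moment_even[of 1]
  by (auto simp: has_bochner_integral_iff integrable_density integral_density)

text \<open>A signed layer-cake formula: \<open>z\<close> is the integral of \<open>[a < z] - [a < 0]\<close> over \<open>a\<close>.\<close>

lemma has_bochner_integral_layer:
  "has_bochner_integral lborel (\<lambda>a. indicator {a<..} z - indicator {a<..} 0) (z :: real)"
  "has_bochner_integral lborel (\<lambda>a. \<bar>indicator {a<..} z - indicator {a<..} 0\<bar>) \<bar>z :: real\<bar>"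
proof -
  have pos: "has_bochner_integral lborel (indicator {0..<z} :: real \<Rightarrow> real) z" if "0 \<le> z"
    using that by (simp add: has_bochner_integral_iff)
  have neg: "has_bochner_integral lborel (indicator {z..<0} :: real \<Rightarrow> real) (- z)" if "z < 0"
    using that by (simp add: has_bochner_integral_iff)
  have eq: "(\<lambda>a. indicator {a<..} z - indicator {a<..} 0 :: real)
      = (if 0 \<le> z then indicator {0..<z} else (\<lambda>a. - indicator {z..<0} a))"
    by (auto simp: fun_eq_iff indicator_def)
  show "has_bochner_integral lborel (\<lambda>a. indicator {a<..} z - indicator {a<..} 0) z"
    unfolding eq using pos has_bochner_integral_minus[OF neg] by auto
  have "(\<lambda>a. \<bar>indicator {a<..} z - indicator {a<..} 0\<bar> :: real)
      = (if 0 \<le> z then indicator {0..<z} else indicator {z..<0})"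
    by (auto simp: fun_eq_iff indicator_def)
  then show "has_bochner_integral lborel (\<lambda>a. \<bar>indicator {a<..} z - indicator {a<..} 0\<bar>) \<bar>z\<bar>"
    using pos neg by auto
qed

section \<open>Covariance of a variable with its Gaussian rearrangement\<close>

locale line_density = \<nu>: atomless_distribution "density lborel (\<lambda>z. ennreal (p z))"
  for p :: "real \<Rightarrow> real" +
  assumes p_measurable[measurable]: "p \<in> borel_measurable borel"
    and p_nonneg: "0 \<le> p z"
begin

abbreviation "\<nu> \<equiv> density lborel (\<lambda>z. ennreal (p z))"
abbreviation "F \<equiv> cdf \<nu>"
abbreviation "S \<equiv> rearrange \<nu> gauss"

lemma F_measurable[measurable]: "F \<in> borel_measurable borel"
  using \<nu>.cdf_measurable .

lemma S_measurable[measurable]: "S \<in> borel_measurable borel"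
  unfolding rearrange_def[abs_def]
  by (rule measurable_compose[OF F_measurable real_distribution.quantile_measurable])
     (rule atomless_distribution.axioms(1)[OF atomless_distribution_gauss])

lemma distr_S: "distr \<nu> borel S = gauss"
  by (intro distr_rearrange \<nu>.atomless_distribution_axioms
        atomless_distribution.axioms(1)[OF atomless_distribution_gauss])

lemma S_moments:
  "integrable \<nu> S" "(\<integral>z. S z \<partial>\<nu>) = 0" "integrable \<nu> (\<lambda>z. (S z)\<^sup>2)" "(\<integral>z. (S z)\<^sup>2 \<partial>\<nu>) = 1"
proof -
  have *: "integrable \<nu> (\<lambda>z. f (S z)) \<longleftrightarrow> integrable gauss f"
    "(\<integral>z. f (S z) \<partial>\<nu>) = (\<integral>x. f x \<partial>gauss)" if f: "f \<in> borel_measurable borel" for f :: "real \<Rightarrow> real"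
  proof -
    have S: "S \<in> \<nu> \<rightarrow>\<^sub>M borel" by simp
    show "integrable \<nu> (\<lambda>z. f (S z)) \<longleftrightarrow> integrable gauss f" "(\<integral>z. f (S z) \<partial>\<nu>) = (\<integral>x. f x \<partial>gauss)"
      using integrable_distr_eq[OF S f] integral_distr[OF S f] unfolding distr_S by auto
  qed
  have m: "(\<lambda>x::real. x) \<in> borel_measurable borel" "(\<lambda>x::real. x\<^sup>2) \<in> borel_measurable borel"
    by simp_all
  show "integrable \<nu> S" "(\<integral>z. S z \<partial>\<nu>) = 0" "integrable \<nu> (\<lambda>z. (S z)\<^sup>2)" "(\<integral>z. (S z)\<^sup>2 \<partial>\<nu>) = 1"
    using *[OF m(1)] *[OF m(2)] gauss_mean gauss_variance by simp_all
qed

text \<open>The limit of g(s) is 0 when s tends to plus or minus infinity, which is the value wanted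
  where \<open>F\<close> is 0 or 1. There \<open>S\<close> only takes the default value 0 of the
  quantile, so the case is separated.\<close>

definition h :: "real \<Rightarrow> real" where
  "h a = (if 0 < F a \<and> F a < 1 then std_normal_density (S a) else 0)"

text \<open>For 0 < F a < 1, off a null set \<open>F\<close> increases strictly beyond a, so the
  event a < z may be replaced by S a < S z and the Gaussian tail formula applies at
  \<open>S a\<close>. If F a = 0 the tail carries the full mean, which is 0; if F a = 1 the tail is
  null.\<close>

lemma tail_mean_S: "(\<integral>z. S z * indicator {a<..} z \<partial>\<nu>) = h a"
proof -
  consider "F a = 0" | "F a = 1" | "0 < F a" "F a < 1"
    using \<nu>.cdf_nonneg[of a] \<nu>.cdf_bounded_prob[of a] by linarith
  then show ?thesis
  proof cases
    case 1
    have "AE z in \<nu>. a < z"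
      using \<nu>.AE_cdf_bounds
    proof eventually_elim
      case (elim z)
      then show ?case using 1 \<nu>.cdf_nondecreasing[of z a] by linarith
    qed
    then have "(\<integral>z. S z * indicator {a<..} z \<partial>\<nu>) = (\<integral>z. S z \<partial>\<nu>)"
      by (intro integral_cong_AE) auto
    then show ?thesis using 1 S_moments by (simp add: h_def)
  next
    case 2
    have "AE z in \<nu>. z < a"
      using \<nu>.AE_cdf_bounds
    proof eventually_elim
      case (elim z)
      then show ?case using 2 \<nu>.cdf_nondecreasing[of a z] by linarith
    qed
    then have "(\<integral>z. S z * indicator {a<..} z \<partial>\<nu>) = (\<integral>z. 0 \<partial>\<nu>)"
      by (intro integral_cong_AE) auto
    then show ?thesis using 2 by (simp add: h_def)
  next
    case 3
    interpret \<gamma>: atomless_distribution gauss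
      by (rule atomless_distribution_gauss)
    have "AE z in \<nu>. S z * indicator {a<..} z = S z * indicator {S a<..} (S z)"
      using \<nu>.AE_cdf_bounds \<nu>.AE_not_flat[of a]
    proof eventually_elim
      case (elim z)
      have "S z \<le> S a \<longleftrightarrow> F z \<le> F a"
        using elim 3 by (simp add: rearrange_def \<gamma>.quantile_le_iff \<gamma>.cdf_quantile)
      also have "\<dots> \<longleftrightarrow> z \<le> a"
        using elim \<nu>.cdf_nondecreasing[of z a] by (auto simp: not_less[symmetric])
      finally show ?case by (auto simp: indicator_def)
    qed
    then have "(\<integral>z. S z * indicator {a<..} z \<partial>\<nu>) = (\<integral>z. S z * indicator {S a<..} (S z) \<partial>\<nu>)"
      by (intro integral_cong_AE) auto
    also have "\<dots> = (\<integral>x. x * indicator {S a<..} x \<partial>distr \<nu> borel S)"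
      by (subst integral_distr) auto
    also have "\<dots> = std_normal_density (S a)"
      by (simp add: distr_S gauss_tail_mean)
    finally show ?thesis using 3 by (simp add: h_def)
  qed
qed

lemma h_nonneg: "0 \<le> h a"
  by (simp add: h_def)

text \<open>A form of Hoeffding's covariance formula: expand z by the signed layer cake, exchange
  the integrals, and recognise tail means. The subtracted indicator of a < 0 contributes nothing
  because \<open>S\<close> has mean zero.\<close>

lemma covariance_eq:
  assumes "integrable \<nu> (\<lambda>z. z * S z)"
  shows "integrable lborel h" "(\<integral>a. h a \<partial>lborel) = (\<integral>z. z * S z \<partial>\<nu>)"
proof -
  interpret P: pair_sigma_finite \<nu> lborel ..
  let ?b = "\<lambda>z a. indicator {a<..} z - indicator {a<..} (0::real) :: real"
  let ?k = "\<lambda>(z, a). S z * ?b z a"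
  have [measurable]: "(\<lambda>x :: real \<times> real. indicator {snd x<..} (fst x) :: real) \<in> borel_measurable (borel \<Otimes>\<^sub>M borel)"
    unfolding indicator_def greaterThan_iff by measurable
  have [measurable]: "(\<lambda>x. indicator {x<..} (0::real) :: real) \<in> borel_measurable borel"
    unfolding indicator_def greaterThan_iff by measurable
  have k: "integrable (\<nu> \<Otimes>\<^sub>M lborel) ?k"
  proof (rule P.Fubini_integrable)
    show "?k \<in> borel_measurable (\<nu> \<Otimes>\<^sub>M lborel)"
      by (simp add: split_beta')
    \<comment> \<open>Absolute layers add up to the absolute value of z, so Fubini's condition is
      exactly the assumed integrability.\<close>
    have "(\<integral>a. norm (?k (z, a)) \<partial>lborel) = \<bar>z * S z\<bar>" for z
      using has_bochner_integral_layer(2)[of z]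
      by (simp add: abs_mult has_bochner_integral_iff)
    then show "integrable \<nu> (\<lambda>z. \<integral>a. norm (?k (z, a)) \<partial>lborel)"
      using assms by simp
    show "AE z in \<nu>. integrable lborel (\<lambda>a. ?k (z, a))"
      using has_bochner_integral_layer(1) by (auto simp: has_bochner_integral_iff)
  qed
  have eq: "(\<integral>z. S z * ?b z a \<partial>\<nu>) = h a" for a
  proof -
    have "integrable \<nu> (\<lambda>z. S z * indicator {a<..} z)"
      using integrable_mult_indicator[OF _ S_moments(1), of "{a<..}"] by (simp add: mult.commute)
    then show ?thesis
      using S_moments(1,2) tail_mean_S[of a] by (simp add: right_diff_distrib)
  qed
  show "integrable lborel h"
    using P.integrable_snd[of "\<lambda>z a. S z * ?b z a"] k by (simp add: eq)
  have "(\<integral>z. z * S z \<partial>\<nu>) = (\<integral>z. \<integral>a. S z * ?b z a \<partial>lborel \<partial>\<nu>)"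
    using has_bochner_integral_layer(1) by (simp add: has_bochner_integral_iff mult.commute)
  also have "\<dots> = (\<integral>a. \<integral>z. S z * ?b z a \<partial>\<nu> \<partial>lborel)"
    using P.Fubini_integral[of "\<lambda>z a. S z * ?b z a"] k by simp
  finally show "(\<integral>a. h a \<partial>lborel) = (\<integral>z. z * S z \<partial>\<nu>)"
    by (simp add: eq)
qed

text \<open>The first integral is E[1 / r]. There \<open>p\<close> cancels, which leaves g(S)
  integrated over the set where \<open>p\<close> is positive, whereas \<open>h\<close> is also
  integrated over the gaps; equality is lost here. Positive and negative parts stay apart so that
  the bound can be integrated over the past before any integrability is known.\<close>

lemma inverse_slope_le:
  assumes "(\<integral>\<^sup>+z. ennreal (z\<^sup>2) \<partial>\<nu>) < \<infinity>"
  shows "(\<integral>\<^sup>+z. ennreal (std_normal_density (S z) / p z) \<partial>\<nu>) + (\<integral>\<^sup>+z. ennreal (- (z * S z)) \<partial>\<nu>)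
    \<le> (\<integral>\<^sup>+z. ennreal (z * S z) \<partial>\<nu>)"
proof -
  have "integrable \<nu> (\<lambda>z. z\<^sup>2)"
    using assms by (intro integrableI_nonneg) auto
  then have "integrable \<nu> (\<lambda>z. z\<^sup>2 + (S z)\<^sup>2)"
    using S_moments by simp
  then have int: "integrable \<nu> (\<lambda>z. z * S z)"
  proof (rule Bochner_Integration.integrable_bound)
    have "\<bar>z * S z\<bar> \<le> \<bar>z\<^sup>2 + (S z)\<^sup>2\<bar>" for z
    proof -
      have "2 * \<bar>z * S z\<bar> \<le> z\<^sup>2 + (S z)\<^sup>2"
        using sum_squares_bound[of "\<bar>z\<bar>" "\<bar>S z\<bar>"] by (simp add: abs_mult)
      then show ?thesis by linarith
    qed
    then show "AE z in \<nu>. norm (z * S z) \<le> norm (z\<^sup>2 + (S z)\<^sup>2)"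
      by simp
  qed simp
  note h = covariance_eq[OF this]
  have "AE z in lborel. 0 < ennreal (p z) \<longrightarrow> 0 < F z \<and> F z < 1"
    using \<nu>.AE_cdf_bounds by (subst (asm) AE_density) auto
  then have le: "AE z in lborel. ennreal (p z) * ennreal (std_normal_density (S z) / p z) \<le> ennreal (h z)"
  proof eventually_elim
    case (elim z)
    then show ?case
      using p_nonneg[of z] by (cases "p z = 0") (auto simp: h_def ennreal_mult[symmetric])
  qed
  have "(\<integral>\<^sup>+z. ennreal (std_normal_density (S z) / p z) \<partial>\<nu>)
      = (\<integral>\<^sup>+z. ennreal (p z) * ennreal (std_normal_density (S z) / p z) \<partial>lborel)"
    by (subst nn_integral_density) auto
  also have "\<dots> \<le> (\<integral>\<^sup>+z. ennreal (h z) \<partial>lborel)"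
    using le by (rule nn_integral_mono_AE)
  also have "\<dots> = ennreal (\<integral>z. z * S z \<partial>\<nu>)"
    using h h_nonneg by (simp add: nn_integral_eq_integral)
  finally have *: "(\<integral>\<^sup>+z. ennreal (std_normal_density (S z) / p z) \<partial>\<nu>) \<le> ennreal (\<integral>z. z * S z \<partial>\<nu>)" .
  have "0 \<le> (\<integral>z. z * S z \<partial>\<nu>)"
    using h_nonneg by (subst h(2)[symmetric]) (rule integral_nonneg_AE, simp)
  moreover have "(\<integral>z. z * S z \<partial>\<nu>)
      = enn2real (\<integral>\<^sup>+z. ennreal (z * S z) \<partial>\<nu>) - enn2real (\<integral>\<^sup>+z. ennreal (- (z * S z)) \<partial>\<nu>)"
    using int by (rule real_lebesgue_integral_def)
  moreover have "(\<integral>\<^sup>+z. ennreal (z * S z) \<partial>\<nu>) \<noteq> \<infinity>" "(\<integral>\<^sup>+z. ennreal (- (z * S z)) \<partial>\<nu>) \<noteq> \<infinity>"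
    using int by (auto simp: real_integrable_def)
  ultimately have "ennreal (\<integral>z. z * S z \<partial>\<nu>) + (\<integral>\<^sup>+z. ennreal (- (z * S z)) \<partial>\<nu>)
      = (\<integral>\<^sup>+z. ennreal (z * S z) \<partial>\<nu>)"
    by (cases "\<integral>\<^sup>+z. ennreal (z * S z) \<partial>\<nu>"; cases "\<integral>\<^sup>+z. ennreal (- (z * S z)) \<partial>\<nu>")
       (auto simp flip: ennreal_plus)
  then show ?thesis
    using add_right_mono[OF *, of "\<integral>\<^sup>+z. ennreal (- (z * S z)) \<partial>\<nu>"] by simp
qed

end

section \<open>Conditional densities\<close>

text \<open>The reference measure is mixed: a probability measure for the past and Lebesgue measure
  for the new coordinate, so that each conditional law has a Lebesgue density as in
  \<open>line_density\<close>.\<close>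

locale joint_density = P: prob_space P for P :: "'a measure" +
  fixes q :: "'a \<Rightarrow> real \<Rightarrow> real"
  assumes q_measurable[measurable]: "case_prod q \<in> borel_measurable (P \<Otimes>\<^sub>M borel)"
    and q_nonneg: "0 \<le> q x z"
    and prob: "prob_space (density (P \<Otimes>\<^sub>M lborel) (\<lambda>w. ennreal (case_prod q w)))"
begin

abbreviation "\<nu> \<equiv> density (P \<Otimes>\<^sub>M lborel) (\<lambda>w. ennreal (case_prod q w))"

sublocale \<nu>: prob_space \<nu>
  by (rule prob)

definition m :: "'a \<Rightarrow> ennreal" where
  "m x = (\<integral>\<^sup>+z. ennreal (q x z) \<partial>lborel)"

text \<open>
  The conditional density of the second coordinate; where the marginal density \<open>m\<close> degenerates
  it is Gaussian, so that \<open>p x\<close> is a probability density for every \<open>x\<close>.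
\<close>

definition p :: "'a \<Rightarrow> real \<Rightarrow> real" where
  "p x z = (if 0 < m x \<and> m x < \<infinity> then q x z / enn2real (m x) else std_normal_density z)"

abbreviation "\<kappa> x \<equiv> density lborel (\<lambda>z. ennreal (p x z))"

definition s :: "'a \<Rightarrow> real \<Rightarrow> real" where
  "s x = rearrange (\<kappa> x) gauss"

definition \<tau> :: "'a \<Rightarrow> real \<Rightarrow> real" where
  "\<tau> x = rearrange gauss (\<kappa> x)"

lemma q_section[measurable]: "x \<in> space P \<Longrightarrow> q x \<in> borel_measurable borel"
  using measurable_compose[OF measurable_Pair1' q_measurable] by simp

lemma m_measurable[measurable]: "m \<in> borel_measurable P"
  unfolding m_def[abs_def] by measurable

lemma p_measurable[measurable]: "case_prod p \<in> borel_measurable (P \<Otimes>\<^sub>M borel)"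
  unfolding p_def[abs_def] by measurable

lemma p_section[measurable]: "x \<in> space P \<Longrightarrow> p x \<in> borel_measurable borel"
  using measurable_compose[OF measurable_Pair1' p_measurable] by simp

lemma p_nonneg: "0 \<le> p x z"
  using q_nonneg by (simp add: p_def)

lemma m_p:
  assumes "0 < m x" "m x < \<infinity>"
  shows "q x z = enn2real (m x) * p x z"
  using assms enn2real_positive_iff[of "m x"] by (simp add: p_def)

lemma line_density_p: "x \<in> space P \<Longrightarrow> line_density (p x)"
proof -
  assume x[measurable]: "x \<in> space P"
  have "prob_space (\<kappa> x)"
  proof (cases "0 < m x \<and> m x < \<infinity>")
    case True
    have "(\<integral>\<^sup>+z. ennreal (p x z) \<partial>lborel) = (\<integral>\<^sup>+z. ennreal (q x z) / m x \<partial>lborel)"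
      using True q_nonneg enn2real_positive_iff[of "m x"]
      by (intro nn_integral_cong) (auto simp: p_def divide_ennreal[symmetric])
    also have "\<dots> = m x / m x"
      by (subst nn_integral_divide) (auto simp: m_def)
    also have "\<dots> = 1"
      using True by (auto intro!: ennreal_divide_self)
    finally show ?thesis
      by (intro prob_spaceI) (simp add: emeasure_density)
  next
    case False
    then have "\<kappa> x = gauss" by (intro density_cong) (auto simp: p_def)
    then show ?thesis using prob_space_gauss by simp
  qed
  then have "atomless_distribution (\<kappa> x)"
    by (rule atomless_distribution_density) simp
  then show ?thesis
    by (intro line_density.intro line_density_axioms.intro p_nonneg) simp_all
qed

lemma nn_integral_m: "(\<integral>\<^sup>+x. m x \<partial>P) = 1"
proof -
  have "(\<integral>\<^sup>+x. m x \<partial>P) = (\<integral>\<^sup>+w. ennreal (case_prod q w) \<partial>(P \<Otimes>\<^sub>M lborel))"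
    by (subst lborel.nn_integral_fst[symmetric]) (auto simp: m_def[abs_def])
  also have "\<dots> = (\<integral>\<^sup>+w. 1 \<partial>\<nu>)"
    by (subst nn_integral_density) auto
  also have "\<dots> = 1"
    using \<nu>.emeasure_space_1 by simp
  finally show ?thesis .
qed

lemma AE_m_finite: "AE x in P. m x < \<infinity>"
  using nn_integral_PInf_AE[of m P] nn_integral_m by (simp add: less_top)

text \<open>Disintegration along the past. The Gaussian fallback in \<open>p\<close> is harmless:
  where m x = 0, the section q x vanishes almost everywhere and both sides are 0, and m x is finite
  almost everywhere.\<close>

lemma nn_integral_\<nu>:
  assumes [measurable]: "f \<in> borel_measurable (P \<Otimes>\<^sub>M borel)"
  shows "(\<integral>\<^sup>+w. f w \<partial>\<nu>) = (\<integral>\<^sup>+x. m x * (\<integral>\<^sup>+z. f (x, z) \<partial>\<kappa> x) \<partial>P)"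
proof -
  have "(\<integral>\<^sup>+w. f w \<partial>\<nu>) = (\<integral>\<^sup>+x. \<integral>\<^sup>+z. ennreal (q x z) * f (x, z) \<partial>lborel \<partial>P)"
    by (subst nn_integral_density) (auto simp: lborel.nn_integral_fst[symmetric])
  also have "\<dots> = (\<integral>\<^sup>+x. m x * (\<integral>\<^sup>+z. f (x, z) \<partial>\<kappa> x) \<partial>P)"
  proof (rule nn_integral_cong_AE)
    show "AE x in P. (\<integral>\<^sup>+z. ennreal (q x z) * f (x, z) \<partial>lborel) = m x * (\<integral>\<^sup>+z. f (x, z) \<partial>\<kappa> x)"
      using AE_m_finite AE_space
    proof eventually_elim
      case (elim x)
      note elim(2)[measurable]
      show ?case
      proof (cases "m x = 0")
        case True
        then have "AE z in lborel. ennreal (q x z) = 0"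
          unfolding m_def by (subst (asm) nn_integral_0_iff_AE) auto
        then have "(\<integral>\<^sup>+z. ennreal (q x z) * f (x, z) \<partial>lborel) = (\<integral>\<^sup>+(z::real). 0 \<partial>lborel)"
          by (intro nn_integral_cong_AE) auto
        then show ?thesis using True by simp
      next
        case False
        then have m: "0 < m x" "m x < \<infinity>" using elim by (auto simp: zero_less_iff_neq_zero)
        have "ennreal (q x z) = m x * ennreal (p x z)" for z
          using m p_nonneg by (subst m_p[OF m]) (auto simp: ennreal_mult)
        then have "(\<integral>\<^sup>+z. ennreal (q x z) * f (x, z) \<partial>lborel)
            = (\<integral>\<^sup>+z. m x * (ennreal (p x z) * f (x, z)) \<partial>lborel)"
          by (simp add: mult.assoc)
        also have "\<dots> = m x * (\<integral>\<^sup>+z. ennreal (p x z) * f (x, z) \<partial>lborel)"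
          by (rule nn_integral_cmult) measurable
        also have "\<dots> = m x * (\<integral>\<^sup>+z. f (x, z) \<partial>\<kappa> x)"
          by (subst nn_integral_density) auto
        finally show ?thesis .
      qed
    qed
  qed
  finally show ?thesis .
qed

lemma sets_\<nu>: "sets \<nu> = sets (P \<Otimes>\<^sub>M borel)"
  by (simp cong: sets_pair_measure_cong)

lemma measurable_\<nu>: "measurable \<nu> M = measurable (P \<Otimes>\<^sub>M borel) M"
  by (intro measurable_cong_sets sets_\<nu> refl)

text \<open>Apply the disintegration to the indicator of the exceptional set: null sections
  contribute 0, and fibres with m x = 0 carry no mass.\<close>

lemma AE_\<nu>I:
  assumes [measurable]: "Measurable.pred (P \<Otimes>\<^sub>M borel) Q"
    and Q: "\<And>x. x \<in> space P \<Longrightarrow> 0 < m x \<Longrightarrow> AE z in \<kappa> x. Q (x, z)"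
  shows "AE w in \<nu>. Q w"
proof -
  have "{w \<in> space (P \<Otimes>\<^sub>M borel). \<not> Q w} \<in> sets (P \<Otimes>\<^sub>M borel)"
    by measurable
  then have meas: "{w \<in> space \<nu>. \<not> Q w} \<in> sets \<nu>"
    using sets_\<nu> sets_eq_imp_space_eq[OF sets_\<nu>] by simp
  have "emeasure \<nu> {w \<in> space \<nu>. \<not> Q w} = (\<integral>\<^sup>+w. (if Q w then 0 else 1) \<partial>\<nu>)"
    unfolding nn_integral_indicator[OF meas, symmetric] by (intro nn_integral_cong) auto
  also have "\<dots> = (\<integral>\<^sup>+x. m x * (\<integral>\<^sup>+z. (if Q (x, z) then 0 else 1) \<partial>\<kappa> x) \<partial>P)"
    by (rule nn_integral_\<nu>) measurable
  also have "\<dots> = (\<integral>\<^sup>+x. 0 \<partial>P)"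
  proof (rule nn_integral_cong)
    fix x assume x: "x \<in> space P"
    show "m x * (\<integral>\<^sup>+z. (if Q (x, z) then 0 else 1) \<partial>\<kappa> x) = 0"
    proof (cases "m x = 0")
      case False
      then have "AE z in \<kappa> x. Q (x, z)"
        using Q[OF x] by (simp add: zero_less_iff_neq_zero)
      then have "(\<integral>\<^sup>+z. (if Q (x, z) then 0 else 1) \<partial>\<kappa> x) = (\<integral>\<^sup>+z. 0 \<partial>\<kappa> x)"
        by (intro nn_integral_cong_AE) auto
      then show ?thesis by simp
    qed simp
  qed
  finally show ?thesis
    using meas by (intro AE_I[where N="{w \<in> space \<nu>. \<not> Q w}"]) auto
qed

text \<open>As an integral with parameters x and z, the distribution function is jointly measurable
  by Tonelli's theorem.\<close>

lemma cdf_\<kappa>_measurable: "(\<lambda>(x, z). cdf (\<kappa> x) z) \<in> borel_measurable (P \<Otimes>\<^sub>M borel)"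
proof -
  have "(\<lambda>(x, z). enn2real (\<integral>\<^sup>+y. (if y \<le> z then ennreal (p x y) else 0) \<partial>lborel)) \<in> borel_measurable (P \<Otimes>\<^sub>M borel)"
    by measurable
  moreover have "cdf (\<kappa> x) z = enn2real (\<integral>\<^sup>+y. (if y \<le> z then ennreal (p x y) else 0) \<partial>lborel)"
    if [measurable]: "x \<in> space P" for x z
    by (auto simp: cdf_def measure_def emeasure_density indicator_def intro!: arg_cong[where f=enn2real] nn_integral_cong)
  ultimately show ?thesis
    by (subst measurable_cong[where g="\<lambda>(x, z). enn2real (\<integral>\<^sup>+y. (if y \<le> z then ennreal (p x y) else 0) \<partial>lborel)"])
       (auto simp: space_pair_measure)
qed

lemma s_measurable[measurable]: "case_prod s \<in> borel_measurable (P \<Otimes>\<^sub>M borel)"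
proof -
  have "(\<lambda>w. quantile (cdf gauss) ((\<lambda>(x, z). cdf (\<kappa> x) z) w)) \<in> borel_measurable (P \<Otimes>\<^sub>M borel)"
    by (rule measurable_compose[OF cdf_\<kappa>_measurable real_distribution.quantile_measurable])
       (rule atomless_distribution.axioms(1)[OF atomless_distribution_gauss])
  then show ?thesis
    by (simp add: s_def rearrange_def split_beta')
qed

text \<open>Unlike for \<open>s\<close>, the quantile function itself varies with x here, so
  measurability of quantiles with a parameter is required.\<close>

lemma \<tau>_measurable[measurable]: "case_prod \<tau> \<in> borel_measurable (P \<Otimes>\<^sub>M borel)"
proof -
  have [measurable]: "cdf gauss \<in> borel_measurable borel"
    by (rule real_distribution.cdf_measurable)
       (rule atomless_distribution.axioms(1)[OF atomless_distribution_gauss])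
  have "(\<lambda>x. cdf (\<kappa> x) a) \<in> borel_measurable P" for a
    using measurable_compose[OF measurable_Pair2'[of a borel P] cdf_\<kappa>_measurable] by simp
  then have [measurable]: "(\<lambda>(x, u). quantile (cdf (\<kappa> x)) u) \<in> borel_measurable (P \<Otimes>\<^sub>M borel)"
    using line_density_p
    by (intro borel_measurable_quantile_kernel)
       (auto simp: line_density_def atomless_distribution_def)
  have "(\<lambda>w. (\<lambda>(x, u). quantile (cdf (\<kappa> x)) u) (fst w, cdf gauss (snd w))) \<in> borel_measurable (P \<Otimes>\<^sub>M borel)"
    by measurable
  then show ?thesis
    by (simp add: \<tau>_def rearrange_def split_beta')
qed

lemma s_section[measurable]: "x \<in> space P \<Longrightarrow> s x \<in> borel_measurable borel"
  using measurable_compose[OF measurable_Pair1' s_measurable] by simp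

lemma distr_s: "x \<in> space P \<Longrightarrow> distr (\<kappa> x) borel (s x) = gauss"
  unfolding s_def by (rule line_density.distr_S[OF line_density_p])

lemma prob_space_marginal: "prob_space (density P m)"
  by (intro prob_spaceI) (simp add: emeasure_density nn_integral_m)

lemma distr_fst: "distr \<nu> P fst = density P m"
proof (rule measure_eqI)
  fix A assume "A \<in> sets (distr \<nu> P fst)"
  then have A[measurable]: "A \<in> sets P" by simp
  have fst: "fst \<in> \<nu> \<rightarrow>\<^sub>M P" unfolding measurable_\<nu> by simp
  have "emeasure (distr \<nu> P fst) A = (\<integral>\<^sup>+x. indicator A x \<partial>distr \<nu> P fst)"
    using A by simp
  also have "\<dots> = (\<integral>\<^sup>+w. indicator A (fst w) \<partial>\<nu>)"
    by (rule nn_integral_distr[OF fst]) simp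
  also have "\<dots> = (\<integral>\<^sup>+x. m x * (\<integral>\<^sup>+z. indicator A x \<partial>\<kappa> x) \<partial>P)"
    by (subst nn_integral_\<nu>) auto
  also have "\<dots> = (\<integral>\<^sup>+x. m x * indicator A x \<partial>P)"
  proof (rule nn_integral_cong)
    fix x assume "x \<in> space P"
    then interpret L: line_density "p x" by (rule line_density_p)
    show "m x * (\<integral>\<^sup>+z. indicator A x \<partial>\<kappa> x) = m x * indicator A x"
      using L.\<nu>.emeasure_space_1 by (simp add: nn_integral_const)
  qed
  also have "\<dots> = emeasure (density P m) A"
    by (simp add: emeasure_density)
  finally show "emeasure (distr \<nu> P fst) A = emeasure (density P m) A" .
qed simp

text \<open>Every \<open>s x\<close> sends its conditional law to the same Gaussian, so the new
  coordinate becomes independent of the past. This creates the product structure of the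
  target.\<close>

lemma distr_step: "distr \<nu> (P \<Otimes>\<^sub>M borel) (\<lambda>(x, z). (x, s x z)) = density P m \<Otimes>\<^sub>M gauss"
proof (rule pair_measure_eqI[symmetric])
  have meas: "(\<lambda>(x, z). (x, s x z)) \<in> \<nu> \<rightarrow>\<^sub>M P \<Otimes>\<^sub>M borel"
    unfolding measurable_\<nu> by measurable
  show "sigma_finite_measure gauss"
    using prob_space_gauss by (rule prob_space_imp_sigma_finite)
  show "sigma_finite_measure (density P m)"
    using prob_space_marginal by (rule prob_space_imp_sigma_finite)
  show "sets (density P m \<Otimes>\<^sub>M gauss) = sets (distr \<nu> (P \<Otimes>\<^sub>M borel) (\<lambda>(x, z). (x, s x z)))"
    by (simp cong: sets_pair_measure_cong)
  fix A B assume "A \<in> sets (density P m)" "B \<in> sets gauss"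
  then have [measurable]: "A \<in> sets P" "B \<in> sets borel" by auto
  have "emeasure (distr \<nu> (P \<Otimes>\<^sub>M borel) (\<lambda>(x, z). (x, s x z))) (A \<times> B)
      = (\<integral>\<^sup>+w. indicator (A \<times> B) w \<partial>distr \<nu> (P \<Otimes>\<^sub>M borel) (\<lambda>(x, z). (x, s x z)))"
    by (subst nn_integral_indicator) auto
  also have "\<dots> = (\<integral>\<^sup>+w. indicator A (fst w) * indicator B (s (fst w) (snd w)) \<partial>\<nu>)"
    by (subst nn_integral_distr[OF meas]) (auto simp: indicator_def intro!: nn_integral_cong)
  also have "\<dots> = (\<integral>\<^sup>+x. m x * (\<integral>\<^sup>+z. indicator A x * indicator B (s x z) \<partial>\<kappa> x) \<partial>P)"
    by (subst nn_integral_\<nu>) auto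
  also have "\<dots> = (\<integral>\<^sup>+x. m x * indicator A x * emeasure gauss B \<partial>P)"
  proof (rule nn_integral_cong)
    fix x assume x[measurable]: "x \<in> space P"
    have "(\<integral>\<^sup>+z. indicator A x * indicator B (s x z) \<partial>\<kappa> x)
        = indicator A x * (\<integral>\<^sup>+z. indicator B (s x z) \<partial>\<kappa> x)"
      by (rule nn_integral_cmult) measurable
    also have "(\<integral>\<^sup>+z. indicator B (s x z) \<partial>\<kappa> x) = (\<integral>\<^sup>+z. indicator B z \<partial>distr (\<kappa> x) borel (s x))"
      by (subst nn_integral_distr) auto
    also have "\<dots> = emeasure gauss B"
      by (simp add: distr_s[OF x])
    finally show "m x * (\<integral>\<^sup>+z. indicator A x * indicator B (s x z) \<partial>\<kappa> x) = m x * indicator A x * emeasure gauss B"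
      by (simp add: mult.assoc)
  qed
  also have "\<dots> = (\<integral>\<^sup>+x. m x * indicator A x \<partial>P) * emeasure gauss B"
    by (rule nn_integral_multc) measurable
  also have "\<dots> = emeasure (density P m) A * emeasure gauss B"
    by (simp add: emeasure_density)
  finally show "emeasure (density P m) A * emeasure gauss B
      = emeasure (distr \<nu> (P \<Otimes>\<^sub>M borel) (\<lambda>(x, z). (x, s x z))) (A \<times> B)" ..
qed

lemma AE_\<tau>_s: "AE (x, z) in \<nu>. \<tau> x (s x z) = z"
proof (rule AE_\<nu>I)
  have "(\<lambda>w. case_prod \<tau> (fst w, s (fst w) (snd w))) \<in> borel_measurable (P \<Otimes>\<^sub>M borel)"
    by measurable
  then show "Measurable.pred (P \<Otimes>\<^sub>M borel) (\<lambda>(x, z). \<tau> x (s x z) = z)"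
    by (simp add: split_beta')
  show "AE z in \<kappa> x. case (x, z) of (x, z) \<Rightarrow> \<tau> x (s x z) = z" if "x \<in> space P" for x
    using AE_rearrange_inverse[OF line_density.axioms(1)[OF line_density_p[OF that]] atomless_distribution_gauss]
    by (simp add: \<tau>_def s_def)
qed

section \<open>The remainder of a single coordinate\<close>

definition gain :: "'a \<times> real \<Rightarrow> real" where
  "gain = (\<lambda>(x, z). 2 * (1 - std_normal_density (s x z) / p x z) + 2 * (z * s x z) - 2 * (s x z)\<^sup>2)"

text \<open>Since E[s^2] = 1, the mean of \<open>gain\<close> is 2 (E[s z] - E[1 / r]). Its sign
  follows from \<open>inverse_slope_le\<close> on each fibre, integrated against
  \<open>m\<close>.\<close>

lemma gain_integral:
  assumes "(\<integral>\<^sup>+w. ennreal ((snd w)\<^sup>2) \<partial>\<nu>) < \<infinity>"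
  shows "integrable \<nu> gain" "0 \<le> (\<integral>w. gain w \<partial>\<nu>)"
proof -
  let ?Z = "\<lambda>w. snd w * s (fst w) (snd w)"
  let ?R = "\<lambda>w. std_normal_density (s (fst w) (snd w)) / p (fst w) (snd w)"
  have [measurable]: "?Z \<in> borel_measurable (P \<Otimes>\<^sub>M borel)" "?R \<in> borel_measurable (P \<Otimes>\<^sub>M borel)"
    by measurable
  have [measurable]: "?Z \<in> borel_measurable \<nu>" "?R \<in> borel_measurable \<nu>"
      "(\<lambda>w. s (fst w) (snd w)) \<in> borel_measurable \<nu>" "(\<lambda>w. (snd w)\<^sup>2) \<in> borel_measurable \<nu>"
    unfolding measurable_\<nu> by measurable
  have sq: "(\<integral>\<^sup>+w. ennreal ((s (fst w) (snd w))\<^sup>2) \<partial>\<nu>) = 1"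
  proof -
    have "(\<integral>\<^sup>+w. ennreal ((s (fst w) (snd w))\<^sup>2) \<partial>\<nu>)
        = (\<integral>\<^sup>+x. m x * (\<integral>\<^sup>+z. ennreal ((s x z)\<^sup>2) \<partial>\<kappa> x) \<partial>P)"
      by (subst nn_integral_\<nu>) auto
    also have "\<dots> = (\<integral>\<^sup>+x. m x \<partial>P)"
    proof (rule nn_integral_cong)
      fix x assume "x \<in> space P"
      then interpret L: line_density "p x" by (rule line_density_p)
      have "(\<integral>\<^sup>+z. ennreal ((s x z)\<^sup>2) \<partial>\<kappa> x) = 1"
        unfolding s_def using L.S_moments(3,4) by (subst nn_integral_eq_integral) auto
      then show "m x * (\<integral>\<^sup>+z. ennreal ((s x z)\<^sup>2) \<partial>\<kappa> x) = m x" by simp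
    qed
    finally show ?thesis by (simp add: nn_integral_m)
  qed
  have int_sq: "integrable \<nu> (\<lambda>w. (s (fst w) (snd w))\<^sup>2)"
    using sq by (intro integrableI_nonneg) auto
  have sq': "(\<integral>w. (s (fst w) (snd w))\<^sup>2 \<partial>\<nu>) = 1"
    using sq by (subst integral_eq_nn_integral) auto
  have "integrable \<nu> (\<lambda>w. (snd w)\<^sup>2)"
    using assms by (intro integrableI_nonneg) auto
  then have "integrable \<nu> (\<lambda>w. (snd w)\<^sup>2 + (s (fst w) (snd w))\<^sup>2)"
    using int_sq by simp
  then have int_Z: "integrable \<nu> ?Z"
  proof (rule Bochner_Integration.integrable_bound)
    have "\<bar>a * b\<bar> \<le> \<bar>a\<^sup>2 + b\<^sup>2\<bar>" for a b :: real
    proof -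
      have "2 * \<bar>a * b\<bar> \<le> a\<^sup>2 + b\<^sup>2"
        using sum_squares_bound[of "\<bar>a\<bar>" "\<bar>b\<bar>"] by (simp add: abs_mult)
      then show ?thesis by linarith
    qed
    then show "AE w in \<nu>. norm (?Z w) \<le> norm ((snd w)\<^sup>2 + (s (fst w) (snd w))\<^sup>2)"
      by simp
  qed simp
  have "(\<integral>\<^sup>+x. m x * (\<integral>\<^sup>+z. ennreal (z\<^sup>2) \<partial>\<kappa> x) \<partial>P) < \<infinity>"
    using assms by (subst (asm) nn_integral_\<nu>) auto
  moreover have "(\<lambda>x. m x * (\<integral>\<^sup>+z. ennreal (z\<^sup>2) \<partial>\<kappa> x)) \<in> borel_measurable P"
    by (subst measurable_cong[where g="\<lambda>x. m x * (\<integral>\<^sup>+z. ennreal (p x z) * ennreal (z\<^sup>2) \<partial>lborel)"])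
       (auto simp: nn_integral_density)
  \<comment> \<open>A finite total second moment forces a finite conditional one for almost every x
    with m x > 0.\<close>
  ultimately have "AE x in P. m x * (\<integral>\<^sup>+z. ennreal (z\<^sup>2) \<partial>\<kappa> x) \<noteq> \<infinity>"
    by (intro nn_integral_PInf_AE) auto
  then have le: "AE x in P. m x * (\<integral>\<^sup>+z. ennreal (?R (x, z)) + ennreal (- ?Z (x, z)) \<partial>\<kappa> x)
      \<le> m x * (\<integral>\<^sup>+z. ennreal (?Z (x, z)) \<partial>\<kappa> x)"
    using AE_space
  proof eventually_elim
    case (elim x)
    then interpret L: line_density "p x" by (intro line_density_p)
    note elim(2)[measurable]
    show ?case
    proof (cases "m x = 0")
      case False
      then have "(\<integral>\<^sup>+z. ennreal (z\<^sup>2) \<partial>\<kappa> x) < \<infinity>"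
        using elim by (auto simp: ennreal_mult_eq_top_iff less_top)
      from L.inverse_slope_le[OF this]
      have "(\<integral>\<^sup>+z. ennreal (?R (x, z)) + ennreal (- ?Z (x, z)) \<partial>\<kappa> x) \<le> (\<integral>\<^sup>+z. ennreal (?Z (x, z)) \<partial>\<kappa> x)"
        by (subst nn_integral_add) (auto simp: s_def)
      then show ?thesis by (rule mult_left_mono) simp
    qed simp
  qed
  have "(\<integral>\<^sup>+w. ennreal (?R w) \<partial>\<nu>) + (\<integral>\<^sup>+w. ennreal (- ?Z w) \<partial>\<nu>)
      = (\<integral>\<^sup>+w. ennreal (?R w) + ennreal (- ?Z w) \<partial>\<nu>)"
    by (subst nn_integral_add) auto
  also have "\<dots> \<le> (\<integral>\<^sup>+w. ennreal (?Z w) \<partial>\<nu>)"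
    using nn_integral_mono_AE[OF le] by (subst (1 2) nn_integral_\<nu>) auto
  finally have main: "(\<integral>\<^sup>+w. ennreal (?R w) \<partial>\<nu>) + (\<integral>\<^sup>+w. ennreal (- ?Z w) \<partial>\<nu>) \<le> (\<integral>\<^sup>+w. ennreal (?Z w) \<partial>\<nu>)" .
  have fin: "(\<integral>\<^sup>+w. ennreal (?Z w) \<partial>\<nu>) \<noteq> \<infinity>" "(\<integral>\<^sup>+w. ennreal (- ?Z w) \<partial>\<nu>) \<noteq> \<infinity>"
    using int_Z by (auto simp: real_integrable_def)
  have R_nonneg: "0 \<le> ?R w" for w
    using p_nonneg by simp
  \<comment> \<open>Integrability of 1 / r comes out of the inequality itself, whose right-hand side
    is finite.\<close>
  have R_fin: "(\<integral>\<^sup>+w. ennreal (?R w) \<partial>\<nu>) \<noteq> \<infinity>"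
    using main fin by (auto simp: top_unique)
  then have int_R: "integrable \<nu> ?R"
    using R_nonneg by (intro integrableI_nonneg) (auto simp: less_top)
  have "(\<integral>w. ?R w \<partial>\<nu>) = enn2real (\<integral>\<^sup>+w. ennreal (?R w) \<partial>\<nu>)"
    using R_nonneg by (intro integral_eq_nn_integral) auto
  moreover have "(\<integral>w. ?Z w \<partial>\<nu>) = enn2real (\<integral>\<^sup>+w. ennreal (?Z w) \<partial>\<nu>) - enn2real (\<integral>\<^sup>+w. ennreal (- ?Z w) \<partial>\<nu>)"
    using int_Z by (rule real_lebesgue_integral_def)
  moreover have "enn2real (\<integral>\<^sup>+w. ennreal (?R w) \<partial>\<nu>) + enn2real (\<integral>\<^sup>+w. ennreal (- ?Z w) \<partial>\<nu>)
      \<le> enn2real (\<integral>\<^sup>+w. ennreal (?Z w) \<partial>\<nu>)"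
    using enn2real_mono[OF main] fin R_fin by (simp add: enn2real_plus less_top)
  ultimately have ineq: "(\<integral>w. ?R w \<partial>\<nu>) \<le> (\<integral>w. ?Z w \<partial>\<nu>)"
    by linarith
  have gain: "gain = (\<lambda>w. 2 * (1 - ?R w) + 2 * ?Z w - 2 * (s (fst w) (snd w))\<^sup>2)"
    by (auto simp: gain_def)
  have combine: "integrable \<nu> (\<lambda>w. 2 * (1 - R w) + 2 * Z w - 2 * Q w)"
      "(\<integral>w. 2 * (1 - R w) + 2 * Z w - 2 * Q w \<partial>\<nu>) = 2 * (1 - (\<integral>w. R w \<partial>\<nu>)) + 2 * (\<integral>w. Z w \<partial>\<nu>) - 2 * (\<integral>w. Q w \<partial>\<nu>)"
    if "integrable \<nu> R" "integrable \<nu> Z" "integrable \<nu> Q" for R Z Q :: "'a \<times> real \<Rightarrow> real"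
    using that \<nu>.prob_space by simp_all
  show "integrable \<nu> gain"
    unfolding gain using int_R int_Z int_sq by (rule combine)
  have "(\<integral>w. gain w \<partial>\<nu>) = 2 * (1 - (\<integral>w. ?R w \<partial>\<nu>)) + 2 * (\<integral>w. ?Z w \<partial>\<nu>) - 2"
    unfolding gain combine(2)[OF int_R int_Z int_sq] sq' by simp
  then show "0 \<le> (\<integral>w. gain w \<partial>\<nu>)"
    using ineq by simp
qed

text \<open>The z^2 of the square cancels against the one in - 2 ln g(z); the rest is ln y \<le> y -
  1 at y = 1 / r. The conditional density is split into \<open>q\<close> and \<open>m\<close> so
  that ln m can cancel against the bound for the past when a coordinate is appended.\<close>

lemma AE_gain:
  "AE (x, z) in \<nu>. 0 < m x \<and> m x < \<infinity> \<and> 0 < q x z \<and>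
    (s x z - z)\<^sup>2 + gain (x, z) \<le> 2 * (ln (q x z) - ln (enn2real (m x)) - ln (std_normal_density z))"
proof -
  interpret L: pair_sigma_finite P lborel ..
  have "{w \<in> space (P \<Otimes>\<^sub>M lborel). m (fst w) < \<infinity>} \<in> sets (P \<Otimes>\<^sub>M lborel)"
    by measurable
  then have "AE w in P \<Otimes>\<^sub>M lborel. m (fst w) < \<infinity>"
    using AE_m_finite by (intro L.AE_pair_measure) (auto elim: eventually_mono)
  then have fin: "AE w in \<nu>. m (fst w) < \<infinity>"
    by (subst AE_density) auto
  have pos: "AE w in \<nu>. 0 < case_prod q w"
    by (subst AE_density) auto
  have "AE w in \<nu>. 0 < m (fst w)"
    by (rule AE_\<nu>I) auto
  with fin pos show ?thesis
  proof eventually_elim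
    case (elim w)
    obtain x z where w: "w = (x, z)" by force
    let ?g = std_normal_density
    have m: "0 < m x" "m x < \<infinity>" and q: "0 < q x z" using elim by (auto simp: w)
    have m': "0 < enn2real (m x)" using m by (simp add: enn2real_positive_iff)
    have p: "0 < p x z" using m_p[OF m, of z] q m' by (simp add: zero_less_mult_iff)
    have g: "0 < ?g y" for y by (simp add: normal_density_pos)
    have lng: "ln (?g y) = - y\<^sup>2 / 2 - ln (sqrt (2 * pi))" for y
      by (simp add: std_normal_density_def ln_mult ln_div)
    have "ln (?g (s x z) / p x z) \<le> ?g (s x z) / p x z - 1"
      using g p by (intro ln_le_minus_one) simp
    then have "ln (?g (s x z)) - ln (p x z) \<le> ?g (s x z) / p x z - 1"
      using g[of "s x z"] p by (simp add: ln_div)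
    moreover have "ln (q x z) - ln (enn2real (m x)) = ln (p x z)"
      using m_p[OF m, of z] p m' by (simp add: ln_mult)
    moreover have "(s x z - z)\<^sup>2 = (s x z)\<^sup>2 + z\<^sup>2 - 2 * (z * s x z)"
      by (simp add: power2_diff)
    ultimately have "(s x z - z)\<^sup>2 + gain (x, z)
        \<le> 2 * (ln (q x z) - ln (enn2real (m x)) - ln (?g z))"
      unfolding gain_def lng by simp
    then show ?case using m q by (simp add: w)
  qed
qed

end

section \<open>The Knothe--Rosenblatt transport\<close>

text \<open>The explicit factor for the first t coordinates lives on R^t and does not mention the
  ambient dimension, so it can be reused unchanged when a coordinate is appended.\<close>

definition adapted :: "nat \<Rightarrow> ((nat \<Rightarrow> real) \<Rightarrow> nat \<Rightarrow> real) \<Rightarrow> bool" where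
  "adapted N S \<longleftrightarrow> S \<in> RN N \<rightarrow>\<^sub>M RN N \<and>
    (\<forall>t\<le>N. \<exists>S'\<in>RN t \<rightarrow>\<^sub>M RN t. \<forall>x\<in>space (RN N). restrict (S x) {1..t} = S' (restrict x {1..t}))"

lemma space_RN: "space (RN N) = extensional {1..N}"
  by (simp add: RN_def space_PiM PiE_def)

lemma restrict_RN: "x \<in> space (RN N) \<Longrightarrow> restrict x {1..N} = x"
  by (simp add: space_RN extensional_restrict)

lemma adaptedI:
  assumes S: "S \<in> RN N \<rightarrow>\<^sub>M RN N"
    and "\<And>t. t < N \<Longrightarrow> \<exists>S'\<in>RN t \<rightarrow>\<^sub>M RN t. \<forall>x\<in>space (RN N). restrict (S x) {1..t} = S' (restrict x {1..t})"
  shows "adapted N S"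
  unfolding adapted_def
proof (intro conjI allI impI S)
  fix t assume "t \<le> N"
  then consider "t < N" | "t = N" by linarith
  then show "\<exists>S'\<in>RN t \<rightarrow>\<^sub>M RN t. \<forall>x\<in>space (RN N). restrict (S x) {1..t} = S' (restrict x {1..t})"
  proof cases
    case 2
    then show ?thesis
      using S measurable_space[OF S]
      by (intro bexI[of _ S]) (auto simp: restrict_RN simp del: One_nat_def)
  qed (rule assms)
qed

lemma adapted_measurable: "adapted N S \<Longrightarrow> S \<in> RN N \<rightarrow>\<^sub>M RN N"
  by (simp add: adapted_def)

definition ext :: "nat \<Rightarrow> (nat \<Rightarrow> real) \<times> real \<Rightarrow> nat \<Rightarrow> real" where
  "ext N = (\<lambda>(x, z). x(Suc N := z))"

definition res :: "nat \<Rightarrow> (nat \<Rightarrow> real) \<Rightarrow> (nat \<Rightarrow> real) \<times> real" where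
  "res N y = (restrict y {1..N}, y (Suc N))"

lemma ext_measurable[measurable]: "ext N \<in> RN N \<Otimes>\<^sub>M borel \<rightarrow>\<^sub>M RN (Suc N)"
  using measurable_add_dim[of "Suc N" "{1..N}" "\<lambda>_. borel"]
  by (simp add: ext_def RN_def atLeastAtMostSuc_conv)

lemma restrict_measurable: "t \<le> N \<Longrightarrow> (\<lambda>x. restrict x {1..t}) \<in> RN N \<rightarrow>\<^sub>M RN t"
  unfolding RN_def by (rule measurable_restrict_subset) auto

lemma component_measurable: "i \<in> {1..N} \<Longrightarrow> (\<lambda>x. x i) \<in> borel_measurable (RN N)"
  unfolding RN_def by (rule measurable_component_singleton)

lemma res_measurable[measurable]: "res N \<in> RN (Suc N) \<rightarrow>\<^sub>M RN N \<Otimes>\<^sub>M borel"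
  unfolding res_def[abs_def] using restrict_measurable[of N "Suc N"] component_measurable[of "Suc N" "Suc N"]
  by (intro measurable_Pair) auto

lemma ext_res: "y \<in> space (RN (Suc N)) \<Longrightarrow> ext N (res N y) = y"
  by (auto simp: ext_def res_def space_RN fun_eq_iff extensional_def restrict_def)

lemma res_ext: "w \<in> space (RN N \<Otimes>\<^sub>M borel) \<Longrightarrow> res N (ext N w) = w"
  by (auto simp: ext_def res_def space_RN fun_eq_iff extensional_def restrict_def space_pair_measure split: prod.splits)

lemma restrict_ext:
  "x \<in> space (RN N) \<Longrightarrow> t \<le> N \<Longrightarrow> restrict (ext N (x, z)) {1..t} = restrict x {1..t}"
  by (auto simp: ext_def restrict_def fun_eq_iff)

lemma sets_std_gaussian: "sets (std_gaussian N) = sets (RN N)"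
  unfolding std_gaussian_def RN_def by (intro sets_PiM_cong) auto

lemma prob_space_std_gaussian: "prob_space (std_gaussian N)"
  unfolding std_gaussian_def by (intro prob_space_PiM prob_space_gauss)

lemma std_gaussian_Suc:
  "std_gaussian (Suc N) = distr (std_gaussian N \<Otimes>\<^sub>M gauss) (RN (Suc N)) (ext N)"
proof -
  interpret gauss: prob_space gauss by (rule prob_space_gauss)
  interpret G: prob_space "std_gaussian N" by (rule prob_space_std_gaussian)
  interpret P: pair_sigma_finite gauss "std_gaussian N" ..
  have insert: "insert (Suc N) {1..N} = {1..Suc N}" by auto
  have cong: "sets (gauss \<Otimes>\<^sub>M std_gaussian N) = sets (borel \<Otimes>\<^sub>M RN N)" "sets (std_gaussian N \<Otimes>\<^sub>M gauss) = sets (RN N \<Otimes>\<^sub>M borel)"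
    by (simp_all add: sets_std_gaussian cong: sets_pair_measure_cong)
  \<comment> \<open>The product over the enlarged index set is assembled with the new factor in
    front, while \<open>ext\<close> takes it last.\<close>
  have swap: "(\<lambda>(x, y). (y, x)) \<in> std_gaussian N \<Otimes>\<^sub>M gauss \<rightarrow>\<^sub>M gauss \<Otimes>\<^sub>M std_gaussian N"
    by measurable
  have ext: "(\<lambda>(z, x). ext N (x, z)) \<in> gauss \<Otimes>\<^sub>M std_gaussian N \<rightarrow>\<^sub>M RN (Suc N)"
    unfolding measurable_cong_sets[OF cong(1) refl] by measurable
  have "std_gaussian (Suc N) = distr (gauss \<Otimes>\<^sub>M std_gaussian N) (std_gaussian (Suc N)) (\<lambda>(z, x). ext N (x, z))"
    using distr_pair_PiM_eq_PiM[of "{1..N}" "\<lambda>_. gauss" "Suc N"] prob_space_gauss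
    unfolding insert by (simp add: std_gaussian_def ext_def)
  also have "\<dots> = distr (gauss \<Otimes>\<^sub>M std_gaussian N) (RN (Suc N)) (\<lambda>(z, x). ext N (x, z))"
    by (intro distr_cong refl sets_std_gaussian)
  also have "\<dots> = distr (std_gaussian N \<Otimes>\<^sub>M gauss) (RN (Suc N)) ((\<lambda>(z, x). ext N (x, z)) \<circ> (\<lambda>(x, y). (y, x)))"
    by (subst P.distr_pair_swap) (rule distr_distr[OF ext swap])
  also have "\<dots> = distr (std_gaussian N \<Otimes>\<^sub>M gauss) (RN (Suc N)) (ext N)"
    by (intro distr_cong) auto
  finally show ?thesis .
qed

text \<open>
  The transport is built one coordinate at a time. The remainder \<open>W\<close> collects the terms
  \<open>2 (1 - 1 / r) + 2 s z - 2 s\<^sup>2\<close> of the single coordinates, so no chain rule for the entropy is needed.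
\<close>

definition knothe ::
  "nat \<Rightarrow> ((nat \<Rightarrow> real) \<Rightarrow> real) \<Rightarrow> (nat \<Rightarrow> real) measure \<Rightarrow> ((nat \<Rightarrow> real) \<Rightarrow> nat \<Rightarrow> real)
    \<Rightarrow> ((nat \<Rightarrow> real) \<Rightarrow> nat \<Rightarrow> real) \<Rightarrow> ((nat \<Rightarrow> real) \<Rightarrow> real) \<Rightarrow> bool" where
  "knothe N f \<nu> S T W \<longleftrightarrow>
    adapted N S \<and> adapted N T \<and> distr \<nu> (RN N) S = std_gaussian N \<and> (AE y in \<nu>. T (S y) = y) \<and>
    integrable \<nu> W \<and> 0 \<le> (\<integral>y. W y \<partial>\<nu>) \<and>
    (AE y in \<nu>. (\<Sum>i=1..N. (S y i - y i)\<^sup>2) + W y \<le> 2 * ln (f y))"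

text \<open>R^0 is a single point, so a probability density equals 1 there, and identity maps with
  zero remainder leave the inequality 0 \<le> 0.\<close>

lemma knothe_0:
  assumes "prob_space (density (std_gaussian 0) (\<lambda>y. ennreal (f y)))" and f: "\<And>y. 0 \<le> f y"
  shows "knothe 0 f (density (std_gaussian 0) (\<lambda>y. ennreal (f y))) (\<lambda>y. y) (\<lambda>y. y) (\<lambda>_. 0)"
proof -
  let ?u = "\<lambda>_. undefined :: real"
  interpret prob_space "density (std_gaussian 0) (\<lambda>y. ennreal (f y))" by fact
  have G: "std_gaussian 0 = count_space {?u}" and R: "RN 0 = count_space {?u}"
    by (simp_all add: std_gaussian_def RN_def PiM_empty)
  have "ennreal (f ?u) = 1"
    using emeasure_space_1 by (simp add: G emeasure_density nn_integral_count_space_finite)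
  then have f1: "f ?u = 1"
    using f by simp
  then have dens: "density (std_gaussian 0) (\<lambda>y. ennreal (f y)) = std_gaussian 0"
  proof -
    have "density (std_gaussian 0) (\<lambda>y. ennreal (f y)) = density (std_gaussian 0) (\<lambda>_. 1)"
    proof (rule density_cong)
      show "AE y in std_gaussian 0. ennreal (f y) = 1"
        unfolding G AE_count_space using f1 by simp
    qed (simp_all add: G)
    then show ?thesis by (simp only: density_1)
  qed
  have "adapted 0 (\<lambda>y. y)"
    by (rule adaptedI) simp_all
  moreover have "AE y in std_gaussian 0. 0 \<le> 2 * ln (f y)"
    unfolding G AE_count_space using f1 by simp
  ultimately show ?thesis
    unfolding dens knothe_def by (simp add: distr_id2 sets_std_gaussian)
qed

section \<open>Appending one coordinate\<close>

locale knothe_step =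
  fixes N :: nat and f :: "(nat \<Rightarrow> real) \<Rightarrow> real"
  assumes f_measurable: "f \<in> borel_measurable (RN (Suc N))"
    and f_nonneg: "0 \<le> f y"
    and prob: "prob_space (density (std_gaussian (Suc N)) (\<lambda>y. ennreal (f y)))"
begin

abbreviation "\<mu> \<equiv> density (std_gaussian (Suc N)) (\<lambda>y. ennreal (f y))"
text \<open>\<open>f\<close> is a density relative to the Gaussian; the extra factor turns the
  reference for the last coordinate into Lebesgue measure.\<close>

abbreviation "q x z \<equiv> f (ext N (x, z)) * std_normal_density z"
abbreviation "\<mu>2 \<equiv> density (std_gaussian N \<Otimes>\<^sub>M lborel) (\<lambda>w. ennreal (case_prod q w))"

lemma measurable_pair: "measurable (std_gaussian N \<Otimes>\<^sub>M borel) M = measurable (RN N \<Otimes>\<^sub>M borel) M"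
  by (intro measurable_cong_sets sets_pair_measure_cong sets_std_gaussian refl)

lemma f_ext_measurable[measurable]: "(\<lambda>w. f (ext N w)) \<in> borel_measurable (std_gaussian N \<Otimes>\<^sub>M borel)"
  unfolding measurable_pair by (rule measurable_compose[OF ext_measurable f_measurable])

lemma q_measurable: "case_prod q \<in> borel_measurable (std_gaussian N \<Otimes>\<^sub>M borel)"
proof -
  have "(\<lambda>w. f (ext N w) * std_normal_density (snd w)) \<in> borel_measurable (std_gaussian N \<Otimes>\<^sub>M borel)"
    by measurable
  then show ?thesis by (simp add: split_beta')
qed

lemma sets_\<mu>2: "sets \<mu>2 = sets (RN N \<Otimes>\<^sub>M borel)"
  by (simp add: sets_std_gaussian cong: sets_pair_measure_cong)

lemma distr_ext: "\<mu> = distr \<mu>2 (RN (Suc N)) (ext N)"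
proof -
  interpret G: prob_space "std_gaussian N" by (rule prob_space_std_gaussian)
  have "density (std_gaussian N) (\<lambda>_. 1) \<Otimes>\<^sub>M gauss
      = density (std_gaussian N \<Otimes>\<^sub>M lborel) (\<lambda>(x, z). 1 * ennreal (std_normal_density z))"
    using prob_space_imp_sigma_finite[OF prob_space_gauss]
    by (intro pair_measure_density) (auto intro: lborel.sigma_finite_measure_axioms)
  then have pair: "std_gaussian N \<Otimes>\<^sub>M gauss = density (std_gaussian N \<Otimes>\<^sub>M lborel) (\<lambda>w. ennreal (std_normal_density (snd w)))"
    by (simp add: density_1 split_beta')
  have ext: "ext N \<in> std_gaussian N \<Otimes>\<^sub>M gauss \<rightarrow>\<^sub>M RN (Suc N)"
    using ext_measurable by (simp add: measurable_pair cong: measurable_cong_sets)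
  have "\<mu> = distr (density (std_gaussian N \<Otimes>\<^sub>M gauss) (\<lambda>w. ennreal (f (ext N w)))) (RN (Suc N)) (ext N)"
    unfolding std_gaussian_Suc using f_measurable by (intro density_distr ext) simp
  also have "density (std_gaussian N \<Otimes>\<^sub>M gauss) (\<lambda>w. ennreal (f (ext N w)))
      = density (std_gaussian N \<Otimes>\<^sub>M lborel) (\<lambda>w. ennreal (std_normal_density (snd w)) * ennreal (f (ext N w)))"
    unfolding pair by (rule density_density_eq) measurable
  also have "\<dots> = \<mu>2"
    using f_nonneg by (intro arg_cong2[where f=density] refl) (auto simp: fun_eq_iff ennreal_mult mult.commute)
  finally show ?thesis .
qed

lemma ext_measurable_\<mu>2: "ext N \<in> \<mu>2 \<rightarrow>\<^sub>M RN (Suc N)"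
  using ext_measurable unfolding measurable_cong_sets[OF sets_\<mu>2 refl] .

sublocale J: joint_density "std_gaussian N" q
proof (intro joint_density.intro joint_density_axioms.intro prob_space_std_gaussian q_measurable)
  show "prob_space \<mu>2"
    by (rule prob_space_distrD[OF ext_measurable_\<mu>2]) (use prob in \<open>simp flip: distr_ext\<close>)
  show "0 \<le> q x z" for x z
    using f_nonneg by simp
qed

lemma distr_res: "distr \<mu> (RN N \<Otimes>\<^sub>M borel) (res N) = \<mu>2"
proof -
  have "distr \<mu> (RN N \<Otimes>\<^sub>M borel) (res N) = distr \<mu>2 (RN N \<Otimes>\<^sub>M borel) (res N \<circ> ext N)"
    by (subst distr_ext) (rule distr_distr[OF res_measurable ext_measurable_\<mu>2])
  also have "\<dots> = distr \<mu>2 (RN N \<Otimes>\<^sub>M borel) (\<lambda>w. w)"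
    using sets_eq_imp_space_eq[OF sets_\<mu>2] by (intro distr_cong) (auto simp: res_ext)
  also have "\<dots> = \<mu>2"
    by (rule distr_id2[OF sets_\<mu>2[symmetric]])
  finally show ?thesis .
qed

lemma measurable_\<mu>: "measurable \<mu> M = measurable (RN (Suc N)) M"
  by (intro measurable_cong_sets) (simp_all add: sets_std_gaussian)

lemma res_measurable_\<mu>: "res N \<in> \<mu> \<rightarrow>\<^sub>M RN N \<Otimes>\<^sub>M borel"
  unfolding measurable_\<mu> by (rule res_measurable)

lemma AE_res: "AE w in \<mu>2. Q w \<Longrightarrow> AE y in \<mu>. Q (res N y)"
  by (rule AE_distrD[OF res_measurable_\<mu>]) (simp only: distr_res)

text \<open>\<open>knothe\<close> expects a real-valued density, whereas \<open>J.m\<close> may be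
  infinite on a null set.\<close>

abbreviation "\<mu>1 \<equiv> density (std_gaussian N) (\<lambda>x. ennreal (enn2real (J.m x)))"

lemma marginal: "\<mu>1 = density (std_gaussian N) J.m"
  using J.AE_m_finite by (intro density_cong) (auto elim!: eventually_mono)

lemma distr_fst_\<mu>2: "distr \<mu>2 (RN N) fst = \<mu>1"
  unfolding marginal J.distr_fst[symmetric] by (intro distr_cong) (simp_all add: sets_std_gaussian)

lemma fst_measurable_\<mu>2: "fst \<in> \<mu>2 \<rightarrow>\<^sub>M RN N"
  unfolding measurable_cong_sets[OF sets_\<mu>2 refl] by simp

lemma AE_fst: "AE x in \<mu>1. Q x \<Longrightarrow> AE w in \<mu>2. Q (fst w)"
  by (rule AE_distrD[OF fst_measurable_\<mu>2]) (simp only: distr_fst_\<mu>2)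

lemma distr_\<mu>1: "distr \<mu> (RN N) (\<lambda>y. restrict y {1..N}) = \<mu>1"
proof -
  have "\<mu>1 = distr (distr \<mu> (RN N \<Otimes>\<^sub>M borel) (res N)) (RN N) fst"
    by (simp add: distr_fst_\<mu>2 distr_res)
  also have "\<dots> = distr \<mu> (RN N) (fst \<circ> res N)"
    by (rule distr_distr[OF _ res_measurable_\<mu>]) simp
  finally show ?thesis
    by (simp add: comp_def res_def)
qed

text \<open>The new coordinate of the forward map uses the true past x. The inverse map sees only S
  x, so it must recover x by \<open>T\<close> before applying the inverse rearrangement that belongs
  to x.\<close>

lemma step:
  assumes IH: "knothe N (\<lambda>x. enn2real (J.m x)) \<mu>1 S T W"
    and moment: "(\<integral>\<^sup>+y. ennreal ((y (Suc N))\<^sup>2) \<partial>\<mu>) < \<infinity>"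
  shows "knothe (Suc N) f \<mu>
    (\<lambda>y. ext N (S (fst (res N y)), case_prod J.s (res N y)))
    (\<lambda>y. ext N (T (fst (res N y)), J.\<tau> (T (fst (res N y))) (snd (res N y))))
    (\<lambda>y. W (fst (res N y)) + J.gain (res N y))"
    (is "knothe _ _ _ ?S ?T ?W")
proof -
  have adS: "adapted N S" and adT: "adapted N T"
    and distrS: "distr \<mu>1 (RN N) S = std_gaussian N"
    and TS: "AE x in \<mu>1. T (S x) = x"
    and W: "integrable \<mu>1 W" "0 \<le> (\<integral>x. W x \<partial>\<mu>1)"
    and le: "AE x in \<mu>1. (\<Sum>i=1..N. (S x i - x i)\<^sup>2) + W x \<le> 2 * ln (enn2real (J.m x))"
    using IH by (auto simp: knothe_def)
  note [measurable] = adapted_measurable[OF adS] adapted_measurable[OF adT]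
  have [measurable]: "case_prod J.s \<in> borel_measurable (RN N \<Otimes>\<^sub>M borel)" "case_prod J.\<tau> \<in> borel_measurable (RN N \<Otimes>\<^sub>M borel)"
    using J.s_measurable J.\<tau>_measurable by (simp_all add: measurable_pair)
  have Sx: "S x \<in> space (RN N)" and Tx: "T x \<in> space (RN N)" if "x \<in> space (RN N)" for x
    using measurable_space[OF adapted_measurable[OF adS] that] measurable_space[OF adapted_measurable[OF adT] that]
    by auto
  have res_space: "fst (res N y) \<in> space (RN N)" if "y \<in> space (RN (Suc N))" for y
    using measurable_space[OF res_measurable that] by (auto simp: space_pair_measure)
  have res_extend: "res N (ext N (x, z)) = (x, z)" if "x \<in> space (RN N)" for x z
    using that by (intro res_ext) (auto simp: space_pair_measure)

  have "(\<lambda>w. case_prod J.\<tau> (T (fst w), snd w)) \<in> borel_measurable (RN N \<Otimes>\<^sub>M borel)"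
    by measurable
  then have [measurable]: "(\<lambda>w. J.\<tau> (T (fst w)) (snd w)) \<in> borel_measurable (RN N \<Otimes>\<^sub>M borel)"
    by simp
  have measS: "?S \<in> RN (Suc N) \<rightarrow>\<^sub>M RN (Suc N)"
    by measurable
  have measT: "?T \<in> RN (Suc N) \<rightarrow>\<^sub>M RN (Suc N)"
    by (rule measurable_compose[OF res_measurable]) measurable
  \<comment> \<open>Whatever the last coordinate g may be, the first N outputs come from R, so the
    factors of R serve again for t \<le> N.\<close>
  have adapted: "adapted (Suc N) (\<lambda>y. ext N (R (fst (res N y)), g y))"
    if R: "adapted N R" and meas: "(\<lambda>y. ext N (R (fst (res N y)), g y)) \<in> RN (Suc N) \<rightarrow>\<^sub>M RN (Suc N)" for R g
  proof (rule adaptedI[OF meas])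
    fix t assume "t < Suc N"
    then have t: "t \<le> N" by simp
    then obtain R' where R': "R' \<in> RN t \<rightarrow>\<^sub>M RN t"
      "\<And>x. x \<in> space (RN N) \<Longrightarrow> restrict (R x) {1..t} = R' (restrict x {1..t})"
      using R by (auto simp: adapted_def)
    have "restrict (ext N (R (fst (res N y)), g y)) {1..t} = R' (restrict y {1..t})"
      if y: "y \<in> space (RN (Suc N))" for y
    proof -
      have "R (fst (res N y)) \<in> space (RN N)"
        using measurable_space[OF adapted_measurable[OF R] res_space[OF y]] .
      then have "restrict (ext N (R (fst (res N y)), g y)) {1..t} = restrict (R (fst (res N y))) {1..t}"
        using t by (rule restrict_ext)
      also have "\<dots> = R' (restrict (fst (res N y)) {1..t})"
        using res_space[OF y] by (rule R')
      also have "restrict (fst (res N y)) {1..t} = restrict y {1..t}"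
        using t by (auto simp: res_def restrict_def fun_eq_iff)
      finally show ?thesis .
    qed
    with R'(1) show "\<exists>S'\<in>RN t \<rightarrow>\<^sub>M RN t. \<forall>x\<in>space (RN (Suc N)).
        restrict (ext N (R (fst (res N x)), g x)) {1..t} = S' (restrict x {1..t})"
      by blast
  qed
  have S': "adapted (Suc N) ?S" and T': "adapted (Suc N) ?T"
    using adapted[OF adS measS] adapted[OF adT measT] .

  have distr: "distr \<mu> (RN (Suc N)) ?S = std_gaussian (Suc N)"
  proof -
    \<comment> \<open>The forward map is split in two: (x, z) goes to (x, s x z), which makes the
      components independent, and then \<open>S\<close> acts on the past alone, preserving the
      product form.\<close>
    let ?E = "\<lambda>w. ext N (S (fst w), snd w)"
    have E: "?E \<in> RN N \<Otimes>\<^sub>M borel \<rightarrow>\<^sub>M RN (Suc N)" by measurable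
    have s: "(\<lambda>(x, z). (x, J.s x z)) \<in> \<mu>2 \<rightarrow>\<^sub>M RN N \<Otimes>\<^sub>M borel"
      unfolding measurable_cong_sets[OF sets_\<mu>2 refl] by measurable
    have "distr \<mu> (RN (Suc N)) ?S = distr \<mu> (RN (Suc N)) ((\<lambda>w. ext N (S (fst w), case_prod J.s w)) \<circ> res N)"
      by (simp add: comp_def)
    also have "\<dots> = distr (distr \<mu> (RN N \<Otimes>\<^sub>M borel) (res N)) (RN (Suc N)) (\<lambda>w. ext N (S (fst w), case_prod J.s w))"
      by (rule distr_distr[OF _ res_measurable_\<mu>, symmetric]) measurable
    also have "\<dots> = distr \<mu>2 (RN (Suc N)) (?E \<circ> (\<lambda>(x, z). (x, J.s x z)))"
      unfolding distr_res by (intro distr_cong) (auto simp: split_beta')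
    also have "\<dots> = distr (distr \<mu>2 (RN N \<Otimes>\<^sub>M borel) (\<lambda>(x, z). (x, J.s x z))) (RN (Suc N)) ?E"
      by (rule distr_distr[OF E s, symmetric])
    also have "distr \<mu>2 (RN N \<Otimes>\<^sub>M borel) (\<lambda>(x, z). (x, J.s x z))
        = distr \<mu>2 (std_gaussian N \<Otimes>\<^sub>M borel) (\<lambda>(x, z). (x, J.s x z))"
      by (intro distr_cong refl sets_pair_measure_cong sets_std_gaussian[symmetric])
    also have "\<dots> = \<mu>1 \<Otimes>\<^sub>M gauss"
      unfolding marginal by (rule J.distr_step)
    also have "distr (\<mu>1 \<Otimes>\<^sub>M gauss) (RN (Suc N)) ?E
        = distr (\<mu>1 \<Otimes>\<^sub>M gauss) (RN (Suc N)) (ext N \<circ> (\<lambda>(x, z). (S x, z)))"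
      by (intro distr_cong) (auto simp: split_beta')
    also have "\<dots> = distr (distr (\<mu>1 \<Otimes>\<^sub>M gauss) (RN N \<Otimes>\<^sub>M borel) (\<lambda>(x, z). (S x, z))) (RN (Suc N)) (ext N)"
    proof (rule distr_distr[OF ext_measurable, symmetric])
      have "sets (\<mu>1 \<Otimes>\<^sub>M gauss) = sets (RN N \<Otimes>\<^sub>M borel)"
        by (simp add: sets_std_gaussian cong: sets_pair_measure_cong)
      then show "(\<lambda>(x, z). (S x, z)) \<in> \<mu>1 \<Otimes>\<^sub>M gauss \<rightarrow>\<^sub>M RN N \<Otimes>\<^sub>M borel"
        by (subst measurable_cong_sets[OF _ refl]) auto
    qed
    also have "distr (\<mu>1 \<Otimes>\<^sub>M gauss) (RN N \<Otimes>\<^sub>M borel) (\<lambda>(x, z). (S x, z))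
        = distr \<mu>1 (RN N) S \<Otimes>\<^sub>M distr gauss borel (\<lambda>z. z)"
    proof (rule pair_measure_distr[symmetric])
      show "S \<in> \<mu>1 \<rightarrow>\<^sub>M RN N"
        using adapted_measurable[OF adS] by (simp add: measurable_cong_sets[OF sets_std_gaussian refl])
      show "sigma_finite_measure (distr gauss borel (\<lambda>z. z))"
        using prob_space_imp_sigma_finite[OF prob_space_gauss] by (simp add: distr_id2)
    qed simp
    also have "\<dots> = std_gaussian N \<Otimes>\<^sub>M gauss"
      by (simp add: distrS distr_id2)
    finally show ?thesis
      by (simp add: std_gaussian_Suc)
  qed

  have space_\<mu>: "AE y in \<mu>. y \<in> space (RN (Suc N))"
    using AE_space[of \<mu>] sets_eq_imp_space_eq[OF sets_std_gaussian[of "Suc N"]] by simp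

  have inv: "AE y in \<mu>. ?T (?S y) = y"
    using AE_res[OF AE_fst[OF TS]] AE_res[OF J.AE_\<tau>_s] space_\<mu>
  proof eventually_elim
    case (elim y)
    obtain x z where xz: "res N y = (x, z)" by force
    have x: "S x \<in> space (RN N)"
      using Sx[OF res_space[OF elim(3)]] by (simp add: xz)
    have "ext N (x, z) = y"
      using ext_res[OF elim(3)] by (simp add: xz)
    then show ?case
      using elim(1,2) by (simp add: xz res_extend[OF x])
  qed

  have gain: "integrable \<mu>2 J.gain" "0 \<le> (\<integral>w. J.gain w \<partial>\<mu>2)"
  proof -
    have "(\<integral>\<^sup>+w. ennreal ((snd w)\<^sup>2) \<partial>\<mu>2) = (\<integral>\<^sup>+w. ennreal ((snd w)\<^sup>2) \<partial>distr \<mu> (RN N \<Otimes>\<^sub>M borel) (res N))"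
      by (simp add: distr_res)
    also have "\<dots> = (\<integral>\<^sup>+y. ennreal ((y (Suc N))\<^sup>2) \<partial>\<mu>)"
      by (subst nn_integral_distr[OF res_measurable_\<mu>]) (auto simp: res_def)
    finally have "(\<integral>\<^sup>+w. ennreal ((snd w)\<^sup>2) \<partial>\<mu>2) < \<infinity>"
      using moment by simp
    then show "integrable \<mu>2 J.gain" "0 \<le> (\<integral>w. J.gain w \<partial>\<mu>2)"
      by (rule J.gain_integral)+
  qed
  have "W \<in> borel_measurable \<mu>1"
    using W(1) by (rule borel_measurable_integrable)
  then have Wm: "W \<in> borel_measurable (RN N)"
    by (simp add: measurable_cong_sets[OF sets_std_gaussian refl])
  have W2: "integrable \<mu>2 (\<lambda>w. W (fst w))" "0 \<le> (\<integral>w. W (fst w) \<partial>\<mu>2)"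
    using W integrable_distr_eq[OF fst_measurable_\<mu>2 Wm] integral_distr[OF fst_measurable_\<mu>2 Wm]
    unfolding distr_fst_\<mu>2 by simp_all
  have total: "integrable \<mu>2 (\<lambda>w. W (fst w) + J.gain w)" "0 \<le> (\<integral>w. W (fst w) + J.gain w \<partial>\<mu>2)"
    using gain W2 by simp_all
  then have "(\<lambda>w. W (fst w) + J.gain w) \<in> borel_measurable (RN N \<Otimes>\<^sub>M borel)"
    using borel_measurable_integrable[OF total(1)] unfolding measurable_cong_sets[OF sets_\<mu>2 refl] by simp
  note * = integrable_distr_eq[OF res_measurable_\<mu> this] integral_distr[OF res_measurable_\<mu> this]
  have W': "integrable \<mu> ?W" "0 \<le> (\<integral>y. ?W y \<partial>\<mu>)"
    using total * unfolding distr_res by simp_all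

  have ineq: "AE y in \<mu>. (\<Sum>i=1..Suc N. (?S y i - y i)\<^sup>2) + ?W y \<le> 2 * ln (f y)"
    using AE_res[OF AE_fst[OF le]] AE_res[OF J.AE_gain] space_\<mu>
  proof eventually_elim
    case (elim y)
    obtain x z where xz: "res N y = (x, z)" by force
    have y: "y = ext N (x, z)"
      using ext_res[OF elim(3)] by (simp add: xz)
    have g: "0 < std_normal_density z" by (simp add: normal_density_pos)
    have q: "0 < q x z" using elim(2) unfolding xz by simp
    then have f: "0 < f y" using g f_nonneg[of y] unfolding y by (simp add: zero_less_mult_iff)
    \<comment> \<open>The Gaussian factor of \<open>q\<close> cancels here, and ln m cancels between
      the induction hypothesis and \<open>J.AE_gain\<close>; only ln f remains.\<close>
    have ln: "ln (q x z) - ln (std_normal_density z) = ln (f y)"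
      using f g unfolding y by (simp add: ln_mult)
    have sum: "(\<Sum>i=1..Suc N. (?S y i - y i)\<^sup>2) = (\<Sum>i=1..N. (S x i - x i)\<^sup>2) + (J.s x z - z)\<^sup>2"
    proof -
      have "(\<Sum>i=1..N. (ext N (S x, J.s x z) i - ext N (x, z) i)\<^sup>2) = (\<Sum>i=1..N. (S x i - x i)\<^sup>2)"
        by (intro sum.cong) (auto simp: ext_def)
      moreover have "(ext N (S x, J.s x z) (Suc N) - ext N (x, z) (Suc N))\<^sup>2 = (J.s x z - z)\<^sup>2"
        by (simp add: ext_def)
      ultimately show ?thesis
        using xz unfolding y by simp
    qed
    have "(\<Sum>i=1..N. (S x i - x i)\<^sup>2) + W x \<le> 2 * ln (enn2real (J.m x))"
      using elim(1) by (simp add: xz)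
    moreover have "(J.s x z - z)\<^sup>2 + J.gain (x, z)
        \<le> 2 * (ln (q x z) - ln (enn2real (J.m x)) - ln (std_normal_density z))"
      using elim(2) unfolding xz by simp
    moreover have W_eq: "?W y = W x + J.gain (x, z)"
      by (simp add: xz)
    ultimately show ?case
      unfolding sum W_eq ln[symmetric] by argo
  qed
  show ?thesis
    unfolding knothe_def by (intro conjI S' T' distr inv W' ineq)
qed

end

text \<open>Induction over the dimension with \<open>f\<close> arbitrary: the law of the first N
  coordinates has its own density \<open>J.m\<close>, and its second moments are among those of the
  full law.\<close>

lemma knothe_exists:
  assumes "f \<in> borel_measurable (RN N)" "\<And>y. 0 \<le> f y"
    and "prob_space (density (std_gaussian N) (\<lambda>y. ennreal (f y)))"
    and "\<And>i. i \<in> {1..N} \<Longrightarrow> (\<integral>\<^sup>+y. ennreal ((y i)\<^sup>2) \<partial>density (std_gaussian N) (\<lambda>y. ennreal (f y))) < \<infinity>"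
  shows "\<exists>S T W. knothe N f (density (std_gaussian N) (\<lambda>y. ennreal (f y))) S T W"
  using assms
proof (induction N arbitrary: f)
  case 0
  from knothe_0[OF 0(3) 0(2)] show ?case
    by (intro exI)
next
  case (Suc N)
  interpret knothe_step N f
    by (rule knothe_step.intro[OF Suc.prems(1-3)])
  have "\<exists>S T W. knothe N (\<lambda>x. enn2real (J.m x)) \<mu>1 S T W"
  proof (rule Suc.IH)
    have "J.m \<in> borel_measurable (RN N)"
      using J.m_measurable by (simp add: measurable_cong_sets[OF sets_std_gaussian refl])
    then show "(\<lambda>x. enn2real (J.m x)) \<in> borel_measurable (RN N)" by measurable
    show "prob_space \<mu>1"
      unfolding marginal by (rule J.prob_space_marginal)
    fix i assume i: "i \<in> {1..N}"
    have R: "(\<lambda>y. restrict y {1..N}) \<in> \<mu> \<rightarrow>\<^sub>M RN N"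
      unfolding measurable_\<mu> by (rule restrict_measurable) simp
    have "(\<integral>\<^sup>+x. ennreal ((x i)\<^sup>2) \<partial>\<mu>1) = (\<integral>\<^sup>+x. ennreal ((x i)\<^sup>2) \<partial>distr \<mu> (RN N) (\<lambda>y. restrict y {1..N}))"
      by (simp only: distr_\<mu>1)
    also have "\<dots> = (\<integral>\<^sup>+y. ennreal ((y i)\<^sup>2) \<partial>\<mu>)"
    proof -
      note component_measurable[OF i, measurable]
      have "(\<lambda>x. ennreal ((x i)\<^sup>2)) \<in> borel_measurable (distr \<mu> (RN N) (\<lambda>y. restrict y {1..N}))"
        by measurable
      from nn_integral_distr[OF R this] show ?thesis
        using i by simp
    qed
    also have "\<dots> < \<infinity>"
      using i by (intro Suc.prems(4)) auto
    finally show "(\<integral>\<^sup>+x. ennreal ((x i)\<^sup>2) \<partial>\<mu>1) < \<infinity>" .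
  qed simp
  then obtain S T W where "knothe N (\<lambda>x. enn2real (J.m x)) \<mu>1 S T W" by blast
  moreover have "(\<integral>\<^sup>+y. ennreal ((y (Suc N))\<^sup>2) \<partial>\<mu>) < \<infinity>"
    by (rule Suc.prems(4)) simp
  ultimately show ?case
    by (intro exI) (rule step)
qed

section \<open>Adapted maps and bicausal couplings\<close>

lemma restrict_space_RN: "(\<lambda>x. restrict x {1..t}) \<in> space (RN N) \<rightarrow> space (RN t)"
  by (simp add: space_RN)

lemma sets_past:
  "sets (past N t) = {(\<lambda>x. restrict x {1..t}) -` B \<inter> space (RN N) | B. B \<in> sets (RN t)}"
  unfolding past_def using restrict_space_RN by (rule sets_vimage_algebra2)

lemma space_past: "space (past N t) = space (RN N)"
  by (simp add: past_def)

lemma sets_past_subset: "t \<le> N \<Longrightarrow> sets (past N t) \<subseteq> sets (RN N)"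
  unfolding sets_past using restrict_measurable by (auto intro: measurable_sets)

text \<open>Translates the factorisation through the first t coordinates into measurability for
  \<open>past\<close>, the form in which causality is expressed.\<close>

lemma adapted_past:
  assumes "adapted N S" "t \<le> N"
  shows "S \<in> past N t \<rightarrow>\<^sub>M past N t"
proof (rule measurableI)
  obtain S' where S': "S' \<in> RN t \<rightarrow>\<^sub>M RN t"
      "\<And>x. x \<in> space (RN N) \<Longrightarrow> restrict (S x) {1..t} = S' (restrict x {1..t})"
    using assms by (auto simp: adapted_def)
  have space: "S x \<in> space (RN N)" if "x \<in> space (RN N)" for x
    using measurable_space[OF adapted_measurable[OF assms(1)] that] .
  then show "S x \<in> space (past N t)" if "x \<in> space (past N t)" for x
    using that by (simp add: space_past)
  fix A assume "A \<in> sets (past N t)"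
  then obtain B where B: "B \<in> sets (RN t)" and A: "A = (\<lambda>x. restrict x {1..t}) -` B \<inter> space (RN N)"
    by (auto simp: sets_past)
  have "S -` A \<inter> space (past N t) = (\<lambda>x. restrict x {1..t}) -` (S' -` B \<inter> space (RN t)) \<inter> space (RN N)"
    using space S'(2) funcset_mem[OF restrict_space_RN] by (auto simp: A space_past simp del: One_nat_def)
  then show "S -` A \<inter> space (past N t) \<in> sets (past N t)"
    unfolding sets_past using measurable_sets[OF S'(1) B] by blast
qed

text \<open>The conditional law is the Dirac mass at T x, so its value on B is the indicator of B at
  T x, which is measurable for the past because \<open>T\<close> is adapted.\<close>

lemma causal_graph:
  assumes \<mu>: "\<mu> \<in> prob_measures N" and T: "adapted N T"
  shows "distr \<mu> (RN N \<Otimes>\<^sub>M RN N) (\<lambda>x. (x, T x)) \<in> causal_couplings N \<mu> (distr \<mu> (RN N) T)"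
proof -
  interpret prob_space \<mu> using \<mu> by (simp add: prob_measures_def)
  have sets_\<mu>: "sets \<mu> = sets (RN N)" using \<mu> by (simp add: prob_measures_def)
  note T_meas = adapted_measurable[OF T]
  have T_\<mu>: "T \<in> \<mu> \<rightarrow>\<^sub>M RN N"
    using T_meas by (simp add: measurable_cong_sets[OF sets_\<mu> refl])
  have graph: "(\<lambda>x. (x, T x)) \<in> \<mu> \<rightarrow>\<^sub>M RN N \<Otimes>\<^sub>M RN N"
    using T_\<mu> by (intro measurable_Pair measurable_ident_sets sets_\<mu>)
  let ?\<gamma> = "distr \<mu> (RN N \<Otimes>\<^sub>M RN N) (\<lambda>x. (x, T x))"
  let ?K = "\<lambda>x. return (RN N) (T x)"
  have "distr ?\<gamma> (RN N) fst = \<mu>"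
    using distr_distr[OF measurable_fst graph] by (simp add: comp_def distr_id2 sets_\<mu>)
  moreover have "distr ?\<gamma> (RN N) snd = distr \<mu> (RN N) T"
    using distr_distr[OF measurable_snd graph] by (simp add: comp_def)
  ultimately have "?\<gamma> \<in> couplings N \<mu> (distr \<mu> (RN N) T)"
    using prob_space_distr[OF graph] by (simp add: couplings_def)
  moreover have "conditional_law N \<mu> ?\<gamma> ?K"
    unfolding conditional_law_def
  proof (intro conjI ballI)
    show "?K \<in> RN N \<rightarrow>\<^sub>M prob_algebra (RN N)"
      by (rule measurable_compose[OF T_meas measurable_return_prob_space])
    fix A B assume A: "A \<in> sets (RN N)" and B: "B \<in> sets (RN N)"
    have inter: "(\<lambda>x. (x, T x)) -` (A \<times> B) \<inter> space \<mu> = A \<inter> (T -` B \<inter> space \<mu>)"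
      using sets.sets_into_space[OF A] sets_eq_imp_space_eq[OF sets_\<mu>] by auto
    have "emeasure ?\<gamma> (A \<times> B) = emeasure \<mu> (A \<inter> (T -` B \<inter> space \<mu>))"
      using A B by (subst emeasure_distr[OF graph]) (simp_all add: inter)
    also have "\<dots> = (\<integral>\<^sup>+x. indicator (A \<inter> (T -` B \<inter> space \<mu>)) x \<partial>\<mu>)"
      using A measurable_sets[OF T_\<mu> B] by (subst nn_integral_indicator) (auto simp: sets_\<mu>)
    also have "\<dots> = (\<integral>\<^sup>+x\<in>A. emeasure (?K x) B \<partial>\<mu>)"
      using B by (intro nn_integral_cong) (auto simp: indicator_def)
    finally show "emeasure ?\<gamma> (A \<times> B) = (\<integral>\<^sup>+x\<in>A. emeasure (?K x) B \<partial>\<mu>)" .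
  qed
  moreover have "measurable_up_to_null \<mu> (past N t) (\<lambda>x. emeasure (?K x) B)"
    if t: "t \<in> {1..N}" and B: "B \<in> sets (past N t)" for t B
  proof -
    have "(\<lambda>x. indicator B (T x)) \<in> borel_measurable (past N t)"
      using adapted_past[OF T] t B by (intro measurable_compose[OF _ borel_measurable_indicator]) auto
    moreover have "B \<in> sets (RN N)"
      using sets_past_subset[of t N] t B by auto
    ultimately show ?thesis
      unfolding measurable_up_to_null_def by (intro bexI[of _ "\<lambda>x. indicator B (T x)"]) auto
  qed
  ultimately show ?thesis
    unfolding causal_couplings_def by blast
qed

text \<open>One coupling has two descriptions: the graph of \<open>T\<close> over the image law and,
  after the swap, the graph of \<open>S\<close> over \<nu>. Each yields causality in one
  direction.\<close>

lemma T_bc2_le: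
  assumes \<nu>: "\<nu> \<in> prob_measures N" and S: "adapted N S" and T: "adapted N T"
    and inv: "AE y in \<nu>. T (S y) = y"
  shows "T_bc2 N (distr \<nu> (RN N) S) \<nu> \<le> (\<integral>\<^sup>+y. ennreal (\<Sum>i=1..N. (S y i - y i)\<^sup>2) \<partial>\<nu>)"
proof -
  let ?G = "distr \<nu> (RN N) S"
  let ?\<gamma> = "distr ?G (RN N \<Otimes>\<^sub>M RN N) (\<lambda>x. (x, T x))"
  interpret prob_space \<nu> using \<nu> by (simp add: prob_measures_def)
  have sets_\<nu>: "sets \<nu> = sets (RN N)" using \<nu> by (simp add: prob_measures_def)
  have S_meas: "S \<in> \<nu> \<rightarrow>\<^sub>M RN N" and T_meas: "T \<in> RN N \<rightarrow>\<^sub>M RN N"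
    using adapted_measurable[OF S] adapted_measurable[OF T] by (simp_all add: measurable_cong_sets[OF sets_\<nu> refl])
  have id_meas: "(\<lambda>y. y) \<in> \<nu> \<rightarrow>\<^sub>M RN N"
    using sets_\<nu> by (rule measurable_ident_sets)
  have TS_meas: "(\<lambda>y. T (S y)) \<in> \<nu> \<rightarrow>\<^sub>M RN N"
    by (rule measurable_compose[OF S_meas T_meas])
  have G: "?G \<in> prob_measures N"
    using prob_space_distr[OF S_meas] by (simp add: prob_measures_def)
  have graph_T: "(\<lambda>x. (x, T x)) \<in> RN N \<rightarrow>\<^sub>M RN N \<Otimes>\<^sub>M RN N"
    by (intro measurable_Pair T_meas measurable_ident_sets refl)
  have \<gamma>: "?\<gamma> = distr \<nu> (RN N \<Otimes>\<^sub>M RN N) (\<lambda>y. (S y, y))"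
  proof -
    have "?\<gamma> = distr \<nu> (RN N \<Otimes>\<^sub>M RN N) (\<lambda>y. (S y, T (S y)))"
      using distr_distr[OF graph_T S_meas] by (simp add: comp_def)
    also have "\<dots> = distr \<nu> (RN N \<Otimes>\<^sub>M RN N) (\<lambda>y. (S y, y))"
      using inv S_meas TS_meas id_meas by (intro distr_cong_AE measurable_Pair) auto
    finally show ?thesis .
  qed
  have "distr ?G (RN N) T = distr \<nu> (RN N) (\<lambda>y. T (S y))"
    using distr_distr[OF T_meas S_meas] by (simp add: comp_def)
  also have "\<dots> = distr \<nu> (RN N) (\<lambda>y. y)"
    using inv TS_meas id_meas by (intro distr_cong_AE) auto
  also have "\<dots> = \<nu>"
    by (simp add: distr_id2 sets_\<nu>)
  finally have 1: "?\<gamma> \<in> causal_couplings N ?G \<nu>"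
    using causal_graph[OF G T] by simp
  have pair: "(\<lambda>y. (S y, y)) \<in> \<nu> \<rightarrow>\<^sub>M RN N \<Otimes>\<^sub>M RN N"
    by (intro measurable_Pair S_meas id_meas)
  have "distr ?\<gamma> (RN N \<Otimes>\<^sub>M RN N) (\<lambda>(x, y). (y, x)) = distr \<nu> (RN N \<Otimes>\<^sub>M RN N) (\<lambda>y. (y, S y))"
    unfolding \<gamma> using distr_distr[OF measurable_pair_swap' pair] by (simp add: comp_def)
  then have 2: "distr ?\<gamma> (RN N \<Otimes>\<^sub>M RN N) (\<lambda>(x, y). (y, x)) \<in> causal_couplings N \<nu> ?G"
    using causal_graph[OF \<nu> S] by simp
  have cost: "(\<lambda>w. ennreal (\<Sum>i=1..N. \<bar>fst w i - snd w i\<bar>\<^sup>2)) \<in> borel_measurable (RN N \<Otimes>\<^sub>M RN N)"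
  proof -
    have [measurable]: "(\<lambda>w. fst w i) \<in> borel_measurable (RN N \<Otimes>\<^sub>M RN N)"
        "(\<lambda>w. snd w i) \<in> borel_measurable (RN N \<Otimes>\<^sub>M RN N)" if "i \<in> {1..N}" for i
      using measurable_compose[OF measurable_fst component_measurable[OF that], of "RN N"]
        measurable_compose[OF measurable_snd component_measurable[OF that], of "RN N"] .
    show ?thesis
      by measurable
  qed
  have "T_bc2 N ?G \<nu> \<le> (\<integral>\<^sup>+(x, y). ennreal (\<Sum>i=1..N. \<bar>x i - y i\<bar>\<^sup>2) \<partial>?\<gamma>)"
    unfolding T_bc2_def bicausal_couplings_def using 1 2 by (intro INF_lower) simp
  also have "\<dots> = (\<integral>\<^sup>+y. ennreal (\<Sum>i=1..N. (S y i - y i)\<^sup>2) \<partial>\<nu>)"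
    unfolding \<gamma> split_beta' using cost by (subst nn_integral_distr[OF pair]) auto
  finally show ?thesis .
qed

section \<open>Finite entropy\<close>

text \<open>The negative part of ln f always has finite integral under \<nu>, so finite entropy
  bounds the positive part as well. The entropy then is an ordinary integral.\<close>

lemma Ent_finiteE:
  assumes G: "prob_space G" and \<nu>: "prob_space \<nu>" and sets: "sets \<nu> = sets G" and fin: "Ent \<nu> G \<noteq> \<infinity>"
  obtains f :: "'a \<Rightarrow> real" where "f \<in> borel_measurable G" "\<And>x. 0 \<le> f x" "\<nu> = density G (\<lambda>x. ennreal (f x))"
    "integrable \<nu> (\<lambda>x. ln (f x))" "Ent \<nu> G = ereal (\<integral>x. ln (f x) \<partial>\<nu>)"
proof -
  interpret G: prob_space G by fact
  interpret \<nu>: prob_space \<nu> by fact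
  define f where "f x = enn2real (RN_deriv G \<nu> x)" for x
  have ac: "absolutely_continuous G \<nu>"
    using fin by (simp add: Ent_def split: if_splits)
  have f_meas[measurable]: "f \<in> borel_measurable G"
    unfolding f_def[abs_def] by measurable
  have f_nonneg: "0 \<le> f x" for x by (simp add: f_def)
  have "AE x in G. RN_deriv G \<nu> x \<noteq> \<infinity>"
    using ac sets \<nu>.sigma_finite_measure_axioms by (intro G.RN_deriv_finite)
  then have dens: "\<nu> = density G (\<lambda>x. ennreal (f x))"
    using G.density_RN_deriv[OF ac sets]
    by (subst (1) \<open>density G (RN_deriv G \<nu>) = \<nu>\<close>[symmetric])
       (intro density_cong, auto simp: f_def less_top elim!: eventually_mono)
  have ln_meas[measurable]: "(\<lambda>x. ln (f x)) \<in> borel_measurable \<nu>"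
    unfolding measurable_cong_sets[OF sets refl] by measurable
  have neg: "(\<integral>\<^sup>+x. ennreal (- ln (f x)) \<partial>\<nu>) \<noteq> \<infinity>"
  proof -
    have "(\<integral>\<^sup>+x. ennreal (- ln (f x)) \<partial>\<nu>) = (\<integral>\<^sup>+x. ennreal (f x) * ennreal (- ln (f x)) \<partial>G)"
      by (subst dens) (rule nn_integral_density, auto)
    also have "\<dots> \<le> (\<integral>\<^sup>+x. 1 \<partial>G)"
    proof (rule nn_integral_mono)
      fix x
      \<comment> \<open>In fact - f ln f \<le> 1 - f, from ln y \<le> y - 1 at y = 1 / f.\<close>
      have "f x * (- ln (f x)) \<le> 1"
      proof (cases "f x = 0")
        case False
        then have f: "0 < f x" using f_nonneg[of x] by simp
        have "- ln (f x) \<le> 1 / f x - 1"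
          using ln_le_minus_one[of "1 / f x"] f by (simp add: ln_div)
        then have "f x * (- ln (f x)) \<le> f x * (1 / f x - 1)"
          using f by (intro mult_left_mono) auto
        also have "\<dots> \<le> 1" using f by (simp add: field_simps)
        finally show ?thesis .
      qed simp
      then have "ennreal (f x * (- ln (f x))) \<le> ennreal 1"
        by (rule ennreal_leI)
      then show "ennreal (f x) * ennreal (- ln (f x)) \<le> 1"
        by (simp only: ennreal_mult'[OF f_nonneg] ennreal_1)
    qed
    finally show ?thesis
      using G.emeasure_space_1 by (auto simp: top_unique)
  qed
  have Ent: "Ent \<nu> G = enn2ereal (\<integral>\<^sup>+x. ennreal (ln (f x)) \<partial>\<nu>) - enn2ereal (\<integral>\<^sup>+x. ennreal (- ln (f x)) \<partial>\<nu>)"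
    using ac by (simp add: Ent_def f_def)
  have pos: "(\<integral>\<^sup>+x. ennreal (ln (f x)) \<partial>\<nu>) \<noteq> \<infinity>"
    using fin unfolding Ent by auto
  have int: "integrable \<nu> (\<lambda>x. ln (f x))"
    using pos neg by (simp add: real_integrable_def)
  have "Ent \<nu> G = ereal (\<integral>x. ln (f x) \<partial>\<nu>)"
    unfolding Ent real_lebesgue_integral_def[OF int]
    using pos neg by (cases "\<integral>\<^sup>+x. ennreal (ln (f x)) \<partial>\<nu>"; cases "\<integral>\<^sup>+x. ennreal (- ln (f x)) \<partial>\<nu>") auto
  with f_meas f_nonneg dens int show ?thesis by (rule that)
qed

text \<open>The product of the exponential and the density is proportional to exp(- z^2 / 4), a
  Gaussian of variance 2; the ratio of the normalising constants is sqrt 2.\<close>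

lemma gauss_exp_moment: "(\<integral>\<^sup>+z. ennreal (exp (z\<^sup>2 / 4)) \<partial>gauss) = ennreal (sqrt 2)"
proof -
  have "std_normal_density z * exp (z\<^sup>2 / 4) = sqrt 2 * normal_density 0 (sqrt 2) z" for z
  proof -
    have "exp (- z\<^sup>2 / 2) * exp (z\<^sup>2 / 4) = exp (- z\<^sup>2 / 4)"
      by (simp add: exp_add[symmetric])
    then show ?thesis
      by (simp add: normal_density_def real_sqrt_mult field_simps)
  qed
  then have "(\<integral>\<^sup>+z. ennreal (exp (z\<^sup>2 / 4)) \<partial>gauss) = (\<integral>\<^sup>+z. ennreal (sqrt 2) * ennreal (normal_density 0 (sqrt 2) z) \<partial>lborel)"
    by (subst nn_integral_density) (auto simp: ennreal_mult[symmetric])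
  also have "\<dots> = ennreal (sqrt 2) * emeasure (density lborel (normal_density 0 (sqrt 2))) UNIV"
    by (subst nn_integral_cmult) (auto simp: emeasure_density)
  also have "\<dots> = ennreal (sqrt 2)"
    using prob_space.emeasure_space_1[OF prob_space_normal_density[of "sqrt 2" 0]] by simp
  finally show ?thesis .
qed

text \<open>Young's inequality \<open>u \<le> ln f - 1 + exp u / f\<close> with \<open>u = y\<^sup>2 / 4\<close>.\<close>

lemma second_moment_finite:
  fixes N :: nat and f :: "(nat \<Rightarrow> real) \<Rightarrow> real"
  defines "\<nu> \<equiv> density (std_gaussian N) (\<lambda>y. ennreal (f y))"
  assumes f: "f \<in> borel_measurable (std_gaussian N)" "\<And>y. 0 \<le> f y"
    and int: "integrable \<nu> (\<lambda>y. ln (f y))" and i: "i \<in> {1..N}"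
  shows "(\<integral>\<^sup>+y. ennreal ((y i)\<^sup>2) \<partial>\<nu>) < \<infinity>"
proof -
  note f(1)[measurable]
  have coord: "(\<lambda>y. y i) \<in> borel_measurable (std_gaussian N)"
    using component_measurable[OF i] by (simp add: measurable_cong_sets[OF sets_std_gaussian refl])
  note coord[measurable]
  have coord_\<nu>[measurable]: "(\<lambda>y. y i) \<in> borel_measurable \<nu>" "f \<in> borel_measurable \<nu>"
    by (simp_all add: \<nu>_def)
  have "AE y in \<nu>. 0 < f y"
    unfolding \<nu>_def by (subst AE_density) auto
  then have "AE y in \<nu>. ennreal ((y i)\<^sup>2 / 4) \<le> ennreal (ln (f y)) + ennreal (exp ((y i)\<^sup>2 / 4) / f y)"
  proof eventually_elim
    case (elim y)
    have "1 + ((y i)\<^sup>2 / 4 - ln (f y)) \<le> exp ((y i)\<^sup>2 / 4 - ln (f y))"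
      by (rule exp_ge_add_one_self)
    also have "\<dots> = exp ((y i)\<^sup>2 / 4) / f y"
      using elim by (simp add: exp_diff)
    finally have "(y i)\<^sup>2 / 4 \<le> max 0 (ln (f y)) + exp ((y i)\<^sup>2 / 4) / f y"
      by linarith
    then have "ennreal ((y i)\<^sup>2 / 4) \<le> ennreal (max 0 (ln (f y)) + exp ((y i)\<^sup>2 / 4) / f y)"
      by (rule ennreal_leI)
    also have "\<dots> = ennreal (ln (f y)) + ennreal (exp ((y i)\<^sup>2 / 4) / f y)"
      using elim by (subst ennreal_plus) (auto simp: max_def ennreal_neg)
    finally show ?case .
  qed
  then have "(\<integral>\<^sup>+y. ennreal ((y i)\<^sup>2 / 4) \<partial>\<nu>)
      \<le> (\<integral>\<^sup>+y. ennreal (ln (f y)) + ennreal (exp ((y i)\<^sup>2 / 4) / f y) \<partial>\<nu>)"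
    by (rule nn_integral_mono_AE)
  also have "\<dots> = (\<integral>\<^sup>+y. ennreal (ln (f y)) \<partial>\<nu>) + (\<integral>\<^sup>+y. ennreal (exp ((y i)\<^sup>2 / 4) / f y) \<partial>\<nu>)"
    by (rule nn_integral_add) measurable
  also have "(\<integral>\<^sup>+y. ennreal (exp ((y i)\<^sup>2 / 4) / f y) \<partial>\<nu>)
      = (\<integral>\<^sup>+y. ennreal (f y) * ennreal (exp ((y i)\<^sup>2 / 4) / f y) \<partial>std_gaussian N)"
    unfolding \<nu>_def by (rule nn_integral_density) measurable
  also have "\<dots> \<le> (\<integral>\<^sup>+y. ennreal (exp ((y i)\<^sup>2 / 4)) \<partial>std_gaussian N)"
  proof (rule nn_integral_mono)
    \<comment> \<open>Equality where f y > 0; where f y = 0 the left side is 0. The weight f thus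
      disappears and a pure Gaussian moment is left.\<close>
    fix y show "ennreal (f y) * ennreal (exp ((y i)\<^sup>2 / 4) / f y) \<le> ennreal (exp ((y i)\<^sup>2 / 4))"
      using f(2)[of y] by (cases "f y = 0") (auto simp: ennreal_mult[symmetric])
  qed
  also have "\<dots> = (\<integral>\<^sup>+z. ennreal (exp (z\<^sup>2 / 4)) \<partial>distr (std_gaussian N) gauss (\<lambda>y. y i))"
    by (subst nn_integral_distr) auto
  also have "distr (std_gaussian N) gauss (\<lambda>y. y i) = gauss"
    unfolding std_gaussian_def using i by (intro distr_PiM_component prob_space_gauss)
  also have "(\<integral>\<^sup>+z. ennreal (exp (z\<^sup>2 / 4)) \<partial>gauss) = ennreal (sqrt 2)"
    by (rule gauss_exp_moment)
  finally have "(\<integral>\<^sup>+y. ennreal ((y i)\<^sup>2 / 4) \<partial>\<nu>) \<le> (\<integral>\<^sup>+y. ennreal (ln (f y)) \<partial>\<nu>) + ennreal (sqrt 2)"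
    by (simp add: add_left_mono)
  also have "\<dots> < \<infinity>"
    using int by (auto simp: real_integrable_def less_top)
  finally have "4 * (\<integral>\<^sup>+y. ennreal ((y i)\<^sup>2 / 4) \<partial>\<nu>) < \<infinity>"
    by (simp add: ennreal_mult_less_top)
  moreover have "(\<integral>\<^sup>+y. ennreal ((y i)\<^sup>2) \<partial>\<nu>) = 4 * (\<integral>\<^sup>+y. ennreal ((y i)\<^sup>2 / 4) \<partial>\<nu>)"
  proof -
    have "ennreal ((y i)\<^sup>2) = 4 * ennreal ((y i)\<^sup>2 / 4)" for y
      using ennreal_mult'[of 4 "(y i)\<^sup>2 / 4"] by simp
    then show ?thesis
      by (simp add: nn_integral_cmult)
  qed
  ultimately show ?thesis by simp
qed

theorem proposition5p9:
  fixes N :: nat and \<nu> :: "(nat \<Rightarrow> real) measure"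
  assumes "\<nu> \<in> prob_measures N"
  shows "2 * Ent \<nu> (std_gaussian N) \<ge> enn2ereal (T_bc2 N (std_gaussian N) \<nu>)"
proof (cases "Ent \<nu> (std_gaussian N) = \<infinity>")
  case False
  have prob: "prob_space \<nu>" and sets: "sets \<nu> = sets (RN N)"
    using assms by (auto simp: prob_measures_def)
  obtain f where f: "f \<in> borel_measurable (std_gaussian N)" "\<And>x. 0 \<le> f x"
      "\<nu> = density (std_gaussian N) (\<lambda>x. ennreal (f x))"
    and int: "integrable \<nu> (\<lambda>x. ln (f x))" and Ent: "Ent \<nu> (std_gaussian N) = ereal (\<integral>x. ln (f x) \<partial>\<nu>)"
    using Ent_finiteE[OF prob_space_std_gaussian prob _ False] sets by (metis sets_std_gaussian)
  have "\<exists>S T W. knothe N f \<nu> S T W"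
    unfolding f(3)
  proof (rule knothe_exists)
    show "f \<in> borel_measurable (RN N)"
      using f(1) by (simp add: measurable_cong_sets[OF sets_std_gaussian refl])
    show "prob_space (density (std_gaussian N) (\<lambda>y. ennreal (f y)))"
      using prob by (simp only: f(3)[symmetric])
    show "(\<integral>\<^sup>+y. ennreal ((y i)\<^sup>2) \<partial>density (std_gaussian N) (\<lambda>y. ennreal (f y))) < \<infinity>"
      if "i \<in> {1..N}" for i
      using f(1,2) int[unfolded f(3)] that by (rule second_moment_finite)
  qed (rule f)
  then obtain S T W where S: "adapted N S" and T: "adapted N T"
    and G: "distr \<nu> (RN N) S = std_gaussian N" and inv: "AE y in \<nu>. T (S y) = y"
    and W: "integrable \<nu> W" "0 \<le> (\<integral>y. W y \<partial>\<nu>)"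
    and le: "AE y in \<nu>. (\<Sum>i=1..N. (S y i - y i)\<^sup>2) + W y \<le> 2 * ln (f y)"
    unfolding knothe_def by blast
  have int': "integrable \<nu> (\<lambda>y. 2 * ln (f y) - W y)"
    using int W(1) by simp
  have ge: "AE y in \<nu>. (\<Sum>i=1..N. (S y i - y i)\<^sup>2) \<le> 2 * ln (f y) - W y"
    using le by eventually_elim linarith
  have "T_bc2 N (std_gaussian N) \<nu> \<le> (\<integral>\<^sup>+y. ennreal (\<Sum>i=1..N. (S y i - y i)\<^sup>2) \<partial>\<nu>)"
    using T_bc2_le[OF assms S T inv] by (simp only: G)
  also have "\<dots> \<le> (\<integral>\<^sup>+y. ennreal (2 * ln (f y) - W y) \<partial>\<nu>)"
    using ge by (intro nn_integral_mono_AE) (auto elim!: eventually_mono intro: ennreal_leI)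
  also have "\<dots> = ennreal (\<integral>y. 2 * ln (f y) - W y \<partial>\<nu>)"
  proof (rule nn_integral_eq_integral[OF int'])
    show "AE y in \<nu>. 0 \<le> 2 * ln (f y) - W y"
      using ge
    proof eventually_elim
      case (elim y)
      have "0 \<le> (\<Sum>i=1..N. (S y i - y i)\<^sup>2)" by (intro sum_nonneg) simp
      then show ?case using elim by linarith
    qed
  qed
  \<comment> \<open>The mean of \<open>W\<close> is nonnegative, so \<open>W\<close> may be
    dropped.\<close>
  also have "\<dots> \<le> ennreal (2 * (\<integral>y. ln (f y) \<partial>\<nu>))"
    using int W by (intro ennreal_leI) simp
  finally have main: "T_bc2 N (std_gaussian N) \<nu> \<le> ennreal (2 * (\<integral>y. ln (f y) \<partial>\<nu>))" .
  \<comment> \<open>\<open>ennreal\<close> would truncate a negative number to 0, so the sign is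
    needed before the bound is read in the extended reals.\<close>
  have nonneg: "0 \<le> 2 * (\<integral>y. ln (f y) \<partial>\<nu>)"
  proof -
    have "0 \<le> (\<integral>y. 2 * ln (f y) - W y \<partial>\<nu>)"
    proof (rule integral_nonneg_AE)
      show "AE y in \<nu>. 0 \<le> 2 * ln (f y) - W y"
        using ge
      proof eventually_elim
        case (elim y)
        have "0 \<le> (\<Sum>i=1..N. (S y i - y i)\<^sup>2)" by (intro sum_nonneg) simp
        then show ?case using elim by linarith
      qed
    qed
    then show ?thesis using int W by simp
  qed
  have "enn2ereal (T_bc2 N (std_gaussian N) \<nu>) \<le> enn2ereal (ennreal (2 * (\<integral>y. ln (f y) \<partial>\<nu>)))"
    using main by (simp only: less_eq_ennreal.rep_eq)
  then show ?thesis
    using nonneg by (simp add: Ent enn2ereal_ennreal)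
qed simp

end
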